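(* Let $k\ge 2$ and consider the Game of Cycles on the $3$-$2$-$k$ graph. Player 1 has a winning strategy if $k$ is even, and Player 2 has a winning strategy if $k$ is odd.
   Context: Game of Cycles: the gameboard is a simple connected graph drawn in the plane without crossings. Players 1 and 2 alternate turns, Player 1 first; on a turn a player must, if possible, direct one currently undirected edge, and it is illegal to create a sink (a vertex all of whose incident edges point into it) or a source (a vertex all of whose incident edges point out of it). A cycle cell is a cycle of the graph bounding a bounded face of the drawing; a player who directs an edge so that all edges of some cycle cell are directed consistently around it wins immediately. Otherwise the player who makes the last legal move wins. A $j$-$2$-$k$ graph consists of two vertices joined by three internally disjoint paths: an upper path with $j$ edges, a middle path with $2$ edges, and a lower path with $k$ edges, all other vertices having degree $2$; it is drawn with the middle path between the upper and lower paths, so its cycle cells are the $(j+2)$-cycle formed by the upper and middle paths and the $(k+2)$-cycle formed by the middle and lower paths. *)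

theory Defs
  imports Main
begin

text \<open>
  A gameboard is a simple connected graph together with the cycles that bound the bounded
  faces of the chosen plane drawing. The drawing enters the rules of the game only through
  these cycle cells, so it is recorded by them alone. A cell is given by the list of its
  vertices in cyclic order; starting point and orientation are irrelevant.
\<close>

record 'v board =
  verts :: "'v set"
  edges :: "'v set set"
  cells :: "'v list set"

text \<open>The arcs of a cycle traversed in the order of the list, including the closing arc.\<close>

definition cycle_arcs :: "'v list \<Rightarrow> ('v \<times> 'v) set" where
  "cycle_arcs c = set (zip c (rotate1 c))"

definition adj :: "'v board \<Rightarrow> ('v \<times> 'v) set" where
  "adj B = {(u, v). {u, v} \<in> edges B}"

definition gameboard :: "'v board \<Rightarrow> bool" where
  "gameboard B \<longleftrightarrow>
     finite (verts B) \<and> verts B \<noteq> {} \<and>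
     (\<forall>e\<in>edges B. e \<subseteq> verts B \<and> card e = 2) \<and>
     (\<forall>u\<in>verts B. \<forall>v\<in>verts B. (u, v) \<in> (adj B)\<^sup>*) \<and>
     (\<forall>c\<in>cells B. distinct c \<and> 3 \<le> length c \<and> cycle_arcs c \<subseteq> adj B)"

text \<open>
  A position is the set \<open>D\<close> of arcs chosen so far; \<open>(u, v) \<in> D\<close> means
  that the edge \<open>{u, v}\<close> is directed from \<open>u\<close> to \<open>v\<close>.
\<close>

definition sink :: "'v board \<Rightarrow> ('v \<times> 'v) set \<Rightarrow> 'v \<Rightarrow> bool" where
  "sink B D v \<longleftrightarrow> (\<forall>w. {v, w} \<in> edges B \<longrightarrow> (w, v) \<in> D)"

definition source :: "'v board \<Rightarrow> ('v \<times> 'v) set \<Rightarrow> 'v \<Rightarrow> bool" where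
  "source B D v \<longleftrightarrow> (\<forall>w. {v, w} \<in> edges B \<longrightarrow> (v, w) \<in> D)"

definition legal_move :: "'v board \<Rightarrow> ('v \<times> 'v) set \<Rightarrow> 'v \<times> 'v \<Rightarrow> bool" where
  "legal_move B D m \<longleftrightarrow>
     {fst m, snd m} \<in> edges B \<and> (fst m, snd m) \<notin> D \<and> (snd m, fst m) \<notin> D \<and>
     (\<forall>v\<in>verts B. \<not> sink B (insert m D) v \<and> \<not> source B (insert m D) v)"

definition cell_completed :: "'v board \<Rightarrow> ('v \<times> 'v) set \<Rightarrow> bool" where
  "cell_completed B D \<longleftrightarrow> (\<exists>c\<in>cells B. cycle_arcs c \<subseteq> D \<or> cycle_arcs (rev c) \<subseteq> D)"

definition game_over :: "'v board \<Rightarrow> ('v \<times> 'v) set \<Rightarrow> bool" where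
  "game_over B D \<longleftrightarrow> cell_completed B D \<or> (\<nexists>m. legal_move B D m)"

text \<open>A play is the list of the moves made so far, in chronological order.\<close>

inductive play :: "'v board \<Rightarrow> ('v \<times> 'v) list \<Rightarrow> bool" for B where
  play_Nil: "play B []"
| play_snoc: "play B ms \<Longrightarrow> \<not> game_over B (set ms) \<Longrightarrow> legal_move B (set ms) m \<Longrightarrow> play B (ms @ [m])"

datatype player = Player1 | Player2

text \<open>The player who makes move number \<open>i\<close>, counting from 0.\<close>

definition mover :: "nat \<Rightarrow> player" where
  "mover i = (if even i then Player1 else Player2)"

text \<open>
  The game stops as soon as a cell is completed, and the player completing it wins;
  if it stops for lack of legal moves, the player of the last legal move wins.
  Either way the winner is the player who made the last move.
\<close>

definition won_by :: "'v board \<Rightarrow> player \<Rightarrow> ('v \<times> 'v) list \<Rightarrow> bool" where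
  "won_by B p ms \<longleftrightarrow> game_over B (set ms) \<and> ms \<noteq> [] \<and> mover (length ms - 1) = p"

text \<open>A strategy prescribes a move for every sequence of previous moves.\<close>

type_synonym 'v strategy = "('v \<times> 'v) list \<Rightarrow> 'v \<times> 'v"

definition follows :: "player \<Rightarrow> 'v strategy \<Rightarrow> ('v \<times> 'v) list \<Rightarrow> bool" where
  "follows p \<sigma> ms \<longleftrightarrow> (\<forall>i<length ms. mover i = p \<longrightarrow> ms ! i = \<sigma> (take i ms))"

text \<open>
  The second conjunct rules out strategies that win vacuously by prescribing illegal moves.
  On a finite board every play can be continued to one at which the game is over.
\<close>

definition winning_strategy :: "'v board \<Rightarrow> player \<Rightarrow> 'v strategy \<Rightarrow> bool" where
  "winning_strategy B p \<sigma> \<longleftrightarrow>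
     (\<forall>ms. play B ms \<and> follows p \<sigma> ms \<longrightarrow>
        (game_over B (set ms) \<longrightarrow> won_by B p ms) \<and>
        (\<not> game_over B (set ms) \<and> mover (length ms) = p \<longrightarrow> legal_move B (set ms) (\<sigma> ms)))"

definition has_winning_strategy :: "'v board \<Rightarrow> player \<Rightarrow> bool" where
  "has_winning_strategy B p \<longleftrightarrow> (\<exists>\<sigma>. winning_strategy B p \<sigma>)"

datatype vertex = Left_End | Right_End | Upper nat | Middle | Lower nat

definition path_edges :: "'v list \<Rightarrow> 'v set set" where
  "path_edges p = {{u, v} | u v. (u, v) \<in> set (zip p (tl p))}"

definition upper_path :: "nat \<Rightarrow> vertex list" where
  "upper_path j = Left_End # map Upper [1..<j] @ [Right_End]"

definition middle_path :: "vertex list" where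
  "middle_path = [Left_End, Middle, Right_End]"

definition lower_path :: "nat \<Rightarrow> vertex list" where
  "lower_path k = Left_End # map Lower [1..<k] @ [Right_End]"

text \<open>
  The \<open>j\<close>-\<open>2\<close>-\<open>k\<close> graph. Each cell runs along the outer path
  from the left to the right end and returns through the middle vertex.
  The intended range is \<open>1 \<le> j\<close>, \<open>1 \<le> k\<close>, not both 1, since
  two outer paths of a single edge would be parallel edges.
\<close>

definition j2k_board :: "nat \<Rightarrow> nat \<Rightarrow> vertex board" where
  "j2k_board j k =
     \<lparr> verts = set (upper_path j) \<union> set middle_path \<union> set (lower_path k),
       edges = path_edges (upper_path j) \<union> path_edges middle_path \<union> path_edges (lower_path k),
       cells = {upper_path j @ [Middle], lower_path k @ [Middle]} \<rparr>"

lemma hd_reaches: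
  assumes "set (zip p (tl p)) \<subseteq> R" "x \<in> set p"
  shows "(hd p, x) \<in> R\<^sup>*"
  using assms
proof (induction p)
  case (Cons a p)
  show ?case
  proof (cases "p = []")
    case False
    then have "(a, hd p) \<in> R" "set (zip p (tl p)) \<subseteq> R"
      using Cons.prems(1) by (cases p; auto)+
    with Cons show ?thesis by (auto intro: converse_rtrancl_into_rtrancl)
  qed (use Cons in auto)
qed simp

lemma card_path_edge:
  assumes "distinct p" "e \<in> path_edges p"
  shows "e \<subseteq> set p \<and> card e = 2"
  using assms
proof (induction p)
  case (Cons a p)
  then show ?case
    by (cases p) (auto simp: path_edges_def dest: set_zip_leftD set_zip_rightD)
qed (simp add: path_edges_def)

lemma cycle_arcs_snoc:
  assumes "p \<noteq> []"
  shows "cycle_arcs (p @ [m]) = set (zip p (tl p)) \<union> {(last p, m), (m, hd p)}"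
proof -
  obtain a q where p: "p = a # q" using assms by (cases p) auto
  have "set (zip (a # q @ [m]) (q @ [m, b])) = set (zip (a # q) q) \<union> {(last (a # q), m), (m, b)}" for b
    by (induction q arbitrary: a) auto
  then show ?thesis by (simp add: p cycle_arcs_def)
qed

lemma gameboard_j2k:
  assumes "1 \<le> j" "1 \<le> k"
  shows "gameboard (j2k_board j k)"
proof -
  let ?B = "j2k_board j k"
  let ?P = "{upper_path j, middle_path, lower_path k}"
  have dist: "distinct p" if "p \<in> ?P" for p
    using that by (auto simp: upper_path_def middle_path_def lower_path_def distinct_map inj_on_def)
  have hd: "hd p = Left_End" if "p \<in> ?P" for p
    using that by (auto simp: upper_path_def middle_path_def lower_path_def)
  have verts: "verts ?B = (\<Union>p\<in>?P. set p)" and edges: "edges ?B = (\<Union>p\<in>?P. path_edges p)"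
    by (auto simp: j2k_board_def)
  have arcs: "set (zip p (tl p)) \<subseteq> adj ?B" if "p \<in> ?P" for p
    using that by (auto simp: adj_def edges path_edges_def)
  have sym: "sym (adj ?B)"
    by (auto simp: sym_def adj_def insert_commute)
  have reach: "(Left_End, v) \<in> (adj ?B)\<^sup>*" if "v \<in> verts ?B" for v
    using that hd_reaches[OF arcs] hd unfolding verts by fastforce
  have conn: "(u, v) \<in> (adj ?B)\<^sup>*" if "u \<in> verts ?B" "v \<in> verts ?B" for u v
    using reach[OF that(1)] reach[OF that(2)] sym_rtrancl[OF sym]
    by (meson rtrancl_trans symD)
  have edge: "e \<subseteq> verts ?B \<and> card e = 2" if "e \<in> edges ?B" for e
    using that card_path_edge dist unfolding verts edges by blast
  have mid: "{(Right_End, Middle), (Middle, Left_End)} \<subseteq> adj ?B"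
    by (auto simp: adj_def edges path_edges_def middle_path_def insert_commute)
  have "distinct c \<and> 3 \<le> length c \<and> cycle_arcs c \<subseteq> adj ?B" if cell: "c \<in> cells ?B" for c
  proof -
    obtain p where c: "c = p @ [Middle]" and p: "p \<in> {upper_path j, lower_path k}"
      using cell by (auto simp: j2k_board_def)
    have *: "p \<noteq> []" "hd p = Left_End" "last p = Right_End" "Middle \<notin> set p" "2 \<le> length p"
      using p by (auto simp: upper_path_def lower_path_def)
    show ?thesis
      using * p dist[of p] arcs[of p] mid by (auto simp: c cycle_arcs_snoc)
  qed
  moreover have "finite (verts ?B)" "verts ?B \<noteq> {}"
    by (auto simp: j2k_board_def middle_path_def)
  ultimately show ?thesis
    using conn edge unfolding gameboard_def by blast
qed

end

theory Submission
  imports Defs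
begin

text \<open>
  If \<open>k\<close> is even, Player 1 marks the central edge of the upper path and from then on answers
  each move by marking the mirror image edge in the same left-to-right direction. This is always
  legal, and every cell misses an even number of edges when Player 2 is to move, so Player 2 never
  completes one.

  If \<open>k\<close> is odd, the board has two central edges, one on the upper and one on the lower path,
  and Player 2 can pair them in the same way. Mirroring fails only where it
  leaves Player 1 a cell whose last missing edge is central. Before that happens Player 2 turns to
  one of three kinds of positions: positions where the parity of the total number of moves is
  already decided in his favour, positions where the mirror pairs are exchanged for others, and
  positions of mutual zugzwang, in which the player who touches the upper cell first allows the
  opponent to complete it.
\<close>

section \<open>Winning by always having an answer\<close>

text \<open>Mirroring here means exchanging left and right and reversing all arrows: signs read from
  left to right are kept, while sinks and sources change places. A marked central edge respects this
  symmetry in either direction; an unmarked one is its own mirror image and needs a partner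
  elsewhere.

  For odd \<open>k\<close>, mirroring of the whole board is therefore kept up only while the upper
  and the middle path are empty, or after both central edges are marked. When Player 1 first marks a
  middle edge or an upper end edge, in direction \<open>s\<close> say, the right reply depends on
  the lower path: a mark \<open>s\<close> there helps to fix the parity of the remaining moves, and
  a mark \<open>- s\<close> keeps the lower cell from being completed by a middle path directed
  \<open>- s\<close>. The classes of positions are treated backwards from the end of the play, so
  that a reply may lead into a class already known to be won.\<close>

inductive secured :: "'v board \<Rightarrow> ('v \<times> 'v) set \<Rightarrow> bool" for B where
  securedI: "(\<And>m. legal_move B D m \<Longrightarrow> \<not> cell_completed B (insert m D) \<and>
     (\<exists>m'. legal_move B (insert m D) m' \<and>
        (cell_completed B (insert m' (insert m D)) \<or> secured B (insert m' (insert m D)))))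
     \<Longrightarrow> secured B D"

definition answer :: "'v board \<Rightarrow> ('v \<times> 'v) set \<Rightarrow> 'v \<times> 'v \<Rightarrow> bool" where
  "answer B D m \<longleftrightarrow> legal_move B D m \<and> (cell_completed B (insert m D) \<or> secured B (insert m D))"

lemma secured_answer:
  assumes "secured B D" "legal_move B D m"
  shows "\<not> cell_completed B (insert m D)" "\<exists>m'. answer B (insert m D) m'"
  using assms unfolding answer_def by (blast elim: secured.cases)+

lemma mover_Suc: "mover (Suc i) = p \<longleftrightarrow> mover i \<noteq> p"
  by (cases p) (auto simp: mover_def)

text \<open>Choosing any \<open>answer\<close> whenever it is the turn of \<open>p\<close> keeps
  every position faced by the opponent secured or already won. A stuck opponent loses, as a position
  without legal moves is \<open>secured\<close> vacuously.\<close>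

lemma has_winning_strategyI:
  assumes first: "p = Player1 \<Longrightarrow> \<not> cell_completed B {} \<and> (\<exists>m. answer B {} m)"
    and second: "p = Player2 \<Longrightarrow> secured B {} \<and> \<not> game_over B {}"
  shows "has_winning_strategy B p"
proof -
  define \<sigma> where "\<sigma> ms = (SOME m. answer B (set ms) m)" for ms
  have inv: "(mover (length ms) \<noteq> p \<longrightarrow> cell_completed B (set ms) \<or> secured B (set ms)) \<and>
      (mover (length ms) = p \<longrightarrow> \<not> cell_completed B (set ms) \<and> (\<exists>m. answer B (set ms) m))"
    if "play B ms" "follows p \<sigma> ms" for ms
    using that
  proof induction
    case play_Nil
    then show ?case
      using first second by (cases p) (auto simp: mover_def)
  next
    case (play_snoc ms m)
    have "(ms @ [m]) ! i = \<sigma> (take i (ms @ [m]))" if "i \<le> length ms" "mover i = p" for i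
      using play_snoc.prems that by (simp add: follows_def)
    note moves = this
    have m: "mover (length ms) = p \<Longrightarrow> m = \<sigma> ms"
      using moves[of "length ms"] by simp
    have foll: "follows p \<sigma> ms"
      unfolding follows_def
    proof (intro allI impI)
      fix i assume "i < length ms" "mover i = p"
      then show "ms ! i = \<sigma> (take i ms)"
        using moves[of i] by (simp add: nth_append)
    qed
    show ?case
    proof (cases "mover (length ms) = p")
      case True
      then have "answer B (set ms) m"
        using play_snoc.IH[OF foll] m by (auto simp: \<sigma>_def intro: someI)
      with True show ?thesis
        by (auto simp: answer_def mover_Suc)
    next
      case False
      then have "secured B (set ms)"
        using play_snoc.IH[OF foll] play_snoc.hyps(2) by (auto simp: game_over_def)
      with False show ?thesis
        using secured_answer[OF _ play_snoc.hyps(3)] by (simp add: mover_Suc)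
    qed
  qed
  have "winning_strategy B p \<sigma>"
    unfolding winning_strategy_def
  proof (intro allI impI, elim conjE, intro conjI impI)
    fix ms assume ms: "play B ms" "follows p \<sigma> ms" and over: "game_over B (set ms)"
    have "mover (length ms) \<noteq> p"
      using inv[OF ms] over by (auto simp: game_over_def answer_def)
    \<comment> \<open>For Player 1 the turn rules out the empty play; for Player 2 a game that is
      over at the start would have no last move and no winner, so this case is excluded by
      assumption.\<close>
    moreover from this have "ms \<noteq> []"
      using second over by (cases p) (auto simp: mover_def)
    ultimately show "won_by B p ms"
      using over mover_Suc[of "length ms - 1" p] by (simp add: won_by_def)
  next
    fix ms assume ms: "play B ms" "follows p \<sigma> ms"
      and "\<not> game_over B (set ms) \<and> mover (length ms) = p"
    then have "answer B (set ms) (\<sigma> ms)"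
      using inv[OF ms] by (auto simp: \<sigma>_def intro: someI)
    then show "legal_move B (set ms) (\<sigma> ms)"
      by (simp add: answer_def)
  qed
  then show ?thesis
    by (auto simp: has_winning_strategy_def)
qed

section \<open>Markings\<close>

datatype strand = Up | Mid | Low

fun len :: "nat \<Rightarrow> strand \<Rightarrow> nat" where
  "len k Up = 3"
| "len k Mid = 2"
| "len k Low = k"

text \<open>
  Edges of a strand are numbered from 0, from left to right; the value at an edge is 1 if the edge is
  directed to the right, \<open>-1\<close> if it is directed to the left, and 0 if it is unmarked.
\<close>

type_synonym marking = "strand \<Rightarrow> nat \<Rightarrow> int"

definition upd :: "marking \<Rightarrow> strand \<Rightarrow> nat \<Rightarrow> int \<Rightarrow> marking" where
  "upd f p i s = f(p := (f p)(i := s))"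

lemma upd_apply: "upd f p i s q j = (if q = p \<and> j = i then s else f q j)"
  by (simp add: upd_def)

lemma strand_all: "(\<forall>p. P p) \<longleftrightarrow> P Up \<and> P Mid \<and> P Low"
  by (metis strand.exhaust)

context
  fixes k :: nat
begin

text \<open>Consecutive edges of opposite signs make the vertex of degree 2 between them a sink or a
  source; three equal signs at an end do the same to that end vertex.\<close>

definition valid :: "marking \<Rightarrow> bool" where
  "valid f \<longleftrightarrow>
     (\<forall>p i. i < len k p \<longrightarrow> f p i \<in> {-1, 0, 1}) \<and>
     (\<forall>p i. Suc i < len k p \<longrightarrow> f p i \<noteq> 0 \<longrightarrow> f p (Suc i) \<noteq> - f p i) \<and>
     (\<forall>s\<in>{1, -1}. \<not> (\<forall>p. f p 0 = s) \<and> \<not> (\<forall>p. f p (len k p - 1) = s))"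

definition move :: "marking \<Rightarrow> strand \<Rightarrow> nat \<Rightarrow> int \<Rightarrow> bool" where
  "move f p i s \<longleftrightarrow> i < len k p \<and> f p i = 0 \<and> s \<in> {1, -1} \<and> valid (upd f p i s)"

text \<open>The middle path carries \<open>- s\<close> because a cell runs along an outer path and
  returns through \<open>Middle\<close>, against the numbering from left to right.\<close>

definition cell :: "marking \<Rightarrow> bool" where
  "cell f \<longleftrightarrow> (\<exists>s\<in>{1, -1}. \<exists>p\<in>{Up, Low}. (\<forall>i<len k p. f p i = s) \<and> (\<forall>i<2. f Mid i = - s))"

definition zeros :: "marking \<Rightarrow> nat" where
  "zeros f = card {i. i < 3 \<and> f Up i = 0} + card {i. i < 2 \<and> f Mid i = 0} + card {i. i < k \<and> f Low i = 0}"

inductive good :: "marking \<Rightarrow> bool" where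
  goodI: "(\<And>p i s. move f p i s \<Longrightarrow> \<not> cell (upd f p i s) \<and>
     (\<exists>q j t. move (upd f p i s) q j t \<and>
        (cell (upd (upd f p i s) q j t) \<or> good (upd (upd f p i s) q j t))))
     \<Longrightarrow> good f"

text \<open>The opponent is to move. Both cases of the theorem start in such a position: the empty
  board has \<open>k + 5\<close> edges, and for even \<open>k\<close> the opening move leaves
  \<open>k + 4\<close>.\<close>

definition pos :: "marking \<Rightarrow> bool" where
  "pos f \<longleftrightarrow> valid f \<and> even (zeros f)"

lemma zeros_upd:
  assumes "f p i = 0" "i < len k p" "s \<noteq> 0"
  shows "Suc (zeros (upd f p i s)) = zeros f"
proof -
  have "Suc (card {j. j < n \<and> (g(i := s)) j = 0}) = card {j. j < n \<and> g j = 0}"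
    if "g i = 0" "i < n" for g :: "nat \<Rightarrow> int" and n
  proof -
    have "{j. j < n \<and> g j = 0} = insert i {j. j < n \<and> (g(i := s)) j = 0}"
      using that assms(3) by auto
    then show ?thesis
      using assms(3) by simp
  qed
  from this[of "f p" "len k p"] assms show ?thesis
    by (cases p) (auto simp: zeros_def upd_def)
qed

lemma zeros_move: "move f p i s \<Longrightarrow> Suc (zeros (upd f p i s)) = zeros f"
  by (rule zeros_upd) (auto simp: move_def)

lemma valid_move: "move f p i s \<Longrightarrow> valid (upd f p i s)"
  by (simp add: move_def)

lemma pos_moves:
  assumes "pos f" "move f p i s" "move (upd f p i s) q j t"
  shows "pos (upd (upd f p i s) q j t)"
  using assms zeros_move[of f] zeros_move[of "upd f p i s"] valid_move
  unfolding pos_def by (metis even_Suc)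

text \<open>
  \<^term>\<open>pos\<close> holds automatically after a move and a reply, so it may be assumed of the new position.
\<close>

definition reply :: "(marking \<Rightarrow> bool) \<Rightarrow> marking \<Rightarrow> bool" where
  "reply C g \<longleftrightarrow> (\<exists>q j t. move g q j t \<and>
     (let h = upd g q j t in cell h \<or> (pos h \<longrightarrow> C h \<or> good h)))"

text \<open>A move and its reply use up two unmarked edges, so a class restored by every reply is
  won by induction on \<open>zeros\<close>. The option \<open>good h\<close> inside
  \<open>reply\<close> lets the play leave the class for positions already settled, which chains the
  classes together.\<close>

lemma class_good:
  assumes step: "\<And>f p i s. pos f \<Longrightarrow> C f \<Longrightarrow> move f p i s \<Longrightarrow>
      \<not> cell (upd f p i s) \<and> reply C (upd f p i s)"
    and "pos f" "C f"
  shows "good f"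
  using assms(2,3)
proof (induction "zeros f" arbitrary: f rule: less_induct)
  case less
  show ?case
  proof (rule goodI)
    fix p i s assume m: "move f p i s"
    let ?g = "upd f p i s"
    obtain q j t where m': "move ?g q j t"
      and h: "cell (upd ?g q j t) \<or> (pos (upd ?g q j t) \<longrightarrow> C (upd ?g q j t) \<or> good (upd ?g q j t))"
      using step[OF less.prems m] by (auto simp: reply_def Let_def)
    have "pos (upd ?g q j t)" "zeros (upd ?g q j t) < zeros f"
      using pos_moves[OF less.prems(1) m m'] zeros_move[OF m] zeros_move[OF m'] by auto
    then show "\<not> cell ?g \<and> (\<exists>q j t. move ?g q j t \<and> (cell (upd ?g q j t) \<or> good (upd ?g q j t)))"
      using less.hyps h m' step[OF less.prems m] by blast
  qed
qed

section \<open>Reflection of the board\<close>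

definition refl :: "marking \<Rightarrow> marking" where
  "refl f p i = (if i < len k p then f p (len k p - 1 - i) else f p i)"

lemma refl_upd: "i < len k p \<Longrightarrow> refl (upd f p i s) = upd (refl f) p (len k p - 1 - i) s"
  by (auto simp: fun_eq_iff refl_def upd_apply)

lemma refl_refl: "refl (refl f) = f"
  by (auto simp: fun_eq_iff refl_def)

text \<open>Keeping the signs while exchanging left and right turns sinks into sources and sources
  into sinks, and both are forbidden.\<close>

lemma valid_refl_aux:
  assumes k: "2 \<le> k" and v: "valid f"
  shows "valid (refl f)"
proof -
  have pos: "0 < len k p" for p using k by (cases p) auto
  have r0: "refl f p 0 = f p (len k p - 1)" "refl f p (len k p - 1) = f p 0" for p
    using pos[of p] by (auto simp: refl_def)
  have adj: "refl f p (Suc i) \<noteq> - refl f p i" if i: "Suc i < len k p" and nz: "refl f p i \<noteq> 0" for p i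
  proof
    assume eq: "refl f p (Suc i) = - refl f p i"
    define j where "j = len k p - 2 - i"
    have j: "Suc j < len k p" "len k p - 1 - i = Suc j" "len k p - 1 - Suc i = j"
      using i by (auto simp: j_def)
    with i eq nz have "f p j = - f p (Suc j)" "f p j \<noteq> 0"
      by (simp_all add: refl_def)
    moreover have "\<forall>p i. Suc i < len k p \<longrightarrow> f p i \<noteq> 0 \<longrightarrow> f p (Suc i) \<noteq> - f p i"
      using v by (simp add: valid_def)
    ultimately show False
      using j(1) by (metis minus_minus)
  qed
  show ?thesis
    unfolding valid_def r0
  proof (intro conjI allI impI)
    fix p i assume "i < len k p"
    then show "refl f p i \<in> {-1,0,1}"
      using v by (auto simp: refl_def valid_def)
  qed (use adj v in \<open>auto simp: valid_def\<close>)
qed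

lemma valid_refl: "2 \<le> k \<Longrightarrow> valid (refl f) \<longleftrightarrow> valid f"
  using valid_refl_aux refl_refl by metis

lemma move_refl:
  assumes "2 \<le> k" "move f p i s"
  shows "move (refl f) p (len k p - 1 - i) s"
proof -
  have "i < len k p" using assms by (auto simp: move_def)
  then show ?thesis
    using assms valid_refl_aux[of "upd f p i s"] refl_upd[of i p f s]
    unfolding move_def by (auto simp: refl_def)
qed

lemma cell_refl_aux: "cell f \<Longrightarrow> cell (refl f)"
  by (force simp: cell_def refl_def)

lemma cell_refl: "cell (refl f) \<longleftrightarrow> cell f"
  using cell_refl_aux refl_refl by metis

lemma good_refl_aux:
  assumes k: "2 \<le> k"
  shows "good f \<Longrightarrow> good (refl f)"
proof (induction rule: good.induct)
  case (goodI f)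
  show ?case
  proof (rule good.goodI)
    fix p i s assume m: "move (refl f) p i s"
    let ?i = "len k p - 1 - i"
    have i: "i < len k p" "?i < len k p" "len k p - 1 - ?i = i" using m by (auto simp: move_def)
    have m': "move f p ?i s" using move_refl[OF k m] by (simp add: refl_refl)
    have eq: "upd (refl f) p i s = refl (upd f p ?i s)"
      using i by (simp add: refl_upd)
    obtain q j t where mj: "move (upd f p ?i s) q j t" and c: "\<not> cell (upd f p ?i s)"
      and h: "cell (upd (upd f p ?i s) q j t) \<or> good (refl (upd (upd f p ?i s) q j t))"
      using goodI[OF m'] by auto
    have "j < len k q" using mj by (simp add: move_def)
    then have "upd (upd (refl f) p i s) q (len k q - 1 - j) t = refl (upd (upd f p ?i s) q j t)"
      by (simp add: refl_upd eq)
    moreover have "move (upd (refl f) p i s) q (len k q - 1 - j) t"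
      using move_refl[OF k mj] by (simp add: eq)
    ultimately show "\<not> cell (upd (refl f) p i s) \<and> (\<exists>q j t. move (upd (refl f) p i s) q j t \<and>
       (cell (upd (upd (refl f) p i s) q j t) \<or> good (upd (upd (refl f) p i s) q j t)))"
      using c h by (metis cell_refl eq)
  qed
qed

lemma good_refl: "2 \<le> k \<Longrightarrow> good (refl f) \<longleftrightarrow> good f"
  using good_refl_aux refl_refl by metis

text \<open>As \<open>f\<close> is valid already, a new mark can only conflict with its two
  neighbours on the strand and, at an end edge, with the other two strands at that end.\<close>

lemma moveI:
  assumes "valid f" "i < len k p" "f p i = 0" "s \<in> {1, -1}"
    and "0 < i \<Longrightarrow> f p (i - 1) \<noteq> - s" "Suc i < len k p \<Longrightarrow> f p (Suc i) \<noteq> - s"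
    and "i = 0 \<Longrightarrow> \<exists>q. q \<noteq> p \<and> f q 0 \<noteq> s"
    and "Suc i = len k p \<Longrightarrow> \<exists>q. q \<noteq> p \<and> f q (len k q - 1) \<noteq> s"
  shows "move f p i s"
proof -
  have v1: "f q j \<in> {-1,0,1}" if "j < len k q" for q j using assms(1) that by (simp add: valid_def)
  have v2: "f q (Suc j) \<noteq> - f q j" if "Suc j < len k q" "f q j \<noteq> 0" for q j using assms(1) that by (simp add: valid_def)
  have v3: "\<not> (\<forall>p. f p 0 = t)" "\<not> (\<forall>p. f p (len k p - 1) = t)" if "t \<in> {1,-1}" for t
    using assms(1) that by (auto simp: valid_def)
  let ?g = "upd f p i s"
  have "?g q j \<in> {-1,0,1}" if "j < len k q" for q j
    using v1[OF that] assms(4) by (auto simp: upd_apply)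
  moreover have "?g q (Suc j) \<noteq> - ?g q j" if "Suc j < len k q" "?g q j \<noteq> 0" for q j
  proof (cases "q = p \<and> (i = j \<or> i = Suc j)")
    case True then show ?thesis using assms(2-6) that by (auto simp: upd_apply)
  next
    case False then show ?thesis using v2[of j q] that by (auto simp: upd_apply)
  qed
  moreover have "\<not> (\<forall>q. ?g q 0 = t)" if t: "t \<in> {1,-1}" for t
  proof (cases "i = 0")
    case True
    with assms(7) obtain q where "q \<noteq> p" "f q 0 \<noteq> s" by blast
    with True show ?thesis by (metis upd_apply)
  next
    case False then show ?thesis using v3(1)[OF t] by (auto simp: upd_apply)
  qed
  moreover have "\<not> (\<forall>q. ?g q (len k q - 1) = t)" if t: "t \<in> {1,-1}" for t
  proof (cases "Suc i = len k p")
    case True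
    with assms(8) obtain q where "q \<noteq> p" "f q (len k q - 1) \<noteq> s" by blast
    moreover have "i = len k p - 1" using True by simp
    ultimately show ?thesis by (metis upd_apply)
  next
    case False
    have "?g q (len k q - 1) = f q (len k q - 1)" for q
      using False assms(2) by (auto simp: upd_apply)
    then show ?thesis using v3(2)[OF t] by auto
  qed
  ultimately have "valid ?g" unfolding valid_def by auto
  with assms show ?thesis by (simp add: move_def)
qed

end

lemma replyI:
  "move k g q j t \<Longrightarrow> (pos k (upd g q j t) \<Longrightarrow> cell k (upd g q j t) \<or> C (upd g q j t) \<or> good k (upd g q j t)) \<Longrightarrow> reply k C g"
  by (auto simp: reply_def Let_def)

section \<open>Parity of unmarked edges\<close>

text \<open>Marked neighbours agree, and each unmarked edge is isolated between opposite signs, so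
  the unmarked edges count the sign changes along the path.\<close>

lemma path_parity:
  fixes w :: "nat \<Rightarrow> int"
  assumes w0: "w 0 \<noteq> 0" and wN: "w N \<noteq> 0"
    and adj: "\<And>i. i < N \<Longrightarrow> w i \<noteq> 0 \<Longrightarrow> w (Suc i) \<noteq> - w i"
    and val: "\<And>i. i \<le> N \<Longrightarrow> w i \<in> {-1, 0, 1}"
    and gap: "\<And>i. Suc i < N \<Longrightarrow> w (Suc i) = 0 \<Longrightarrow> w i \<noteq> 0 \<and> w (Suc (Suc i)) = - w i"
  shows "even (card {i. i \<le> N \<and> w i = 0}) \<longleftrightarrow> w N = w 0"
proof -
  define Z where "Z n = card {i. i \<le> n \<and> w i = 0}" for n
  have Z_Suc: "Z (Suc n) = Z n + of_bool (w (Suc n) = 0)" for n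
  proof -
    have "{i. i \<le> Suc n \<and> w i = 0} =
        (if w (Suc n) = 0 then insert (Suc n) {i. i \<le> n \<and> w i = 0} else {i. i \<le> n \<and> w i = 0})"
      by (auto simp: le_Suc_eq)
    then show ?thesis by (simp add: Z_def)
  qed
  have "{i. i \<le> 0 \<and> w i = 0} = {}" using w0 by auto
  then have Z0: "Z 0 = 0" unfolding Z_def by (simp only: card.empty)
  have "even (Z n) \<longleftrightarrow> w n = w 0" if "n \<le> N" "w n \<noteq> 0" for n
    using that
  proof (induction n rule: less_induct)
    case (less n)
    show ?case
    proof (cases n)
      case 0
      then show ?thesis by (simp add: Z0)
    next
      case n: (Suc m)
      show ?thesis
      proof (cases "w m = 0")
        case False
        have "w n = w m"
          using adj[of m] val[of m] val[of n] less.prems False n by auto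
        moreover have "even (Z m) \<longleftrightarrow> w m = w 0"
          using less.IH[of m] less.prems(1) False n by simp
        ultimately show ?thesis
          using less.prems(2) n by (simp add: Z_Suc)
      next
        case True
        \<comment> \<open>The induction jumps over the unmarked edge to the marked one before
          it.\<close>
        then obtain l where m: "m = Suc l" using w0 by (cases m) auto
        have l: "w l \<noteq> 0" "w n = - w l"
          using gap[of l] True less.prems(1) m n by auto
        have "even (Z l) \<longleftrightarrow> w l = w 0"
          using less.IH[of l] less.prems(1) l(1) m n by simp
        moreover have "Z n = Suc (Z l)"
          using True less.prems(2) m n by (simp add: Z_Suc)
        moreover have "w l = w 0 \<longleftrightarrow> w n \<noteq> w 0"
          using l w0 val[of l] val[of 0] less.prems(1) m n by auto
        ultimately show ?thesis by simp
      qed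
    qed
  qed
  from this[of N] wN show ?thesis by (simp add: Z_def)
qed

lemma path_parity_interval:
  fixes w :: "nat \<Rightarrow> int"
  assumes "a \<le> b" "w a \<noteq> 0" "w b \<noteq> 0"
    and "\<And>i. a \<le> i \<Longrightarrow> i < b \<Longrightarrow> w i \<noteq> 0 \<Longrightarrow> w (Suc i) \<noteq> - w i"
    and "\<And>i. a \<le> i \<Longrightarrow> i \<le> b \<Longrightarrow> w i \<in> {-1, 0, 1}"
    and "\<And>i. a \<le> i \<Longrightarrow> Suc i < b \<Longrightarrow> w (Suc i) = 0 \<Longrightarrow> w i \<noteq> 0 \<and> w (Suc (Suc i)) = - w i"
  shows "even (card {i. a \<le> i \<and> i \<le> b \<and> w i = 0}) \<longleftrightarrow> w b = w a"
proof -
  have "{i. a \<le> i \<and> i \<le> b \<and> w i = 0} = (+) a ` {i. i \<le> b - a \<and> w (a + i) = 0}"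
  proof (intro set_eqI iffI)
    fix i assume "i \<in> {i. a \<le> i \<and> i \<le> b \<and> w i = 0}"
    then show "i \<in> (+) a ` {i. i \<le> b - a \<and> w (a + i) = 0}"
      by (intro image_eqI[of _ _ "i - a"]) auto
  qed (use assms(1) in auto)
  then have "card {i. a \<le> i \<and> i \<le> b \<and> w i = 0} = card {i. i \<le> b - a \<and> w (a + i) = 0}"
    by (simp add: card_image)
  moreover have "even (card {i. i \<le> b - a \<and> w (a + i) = 0}) \<longleftrightarrow> w (a + (b - a)) = w (a + 0)"
  proof (rule path_parity)
    fix i assume "Suc i < b - a" "w (a + Suc i) = 0"
    then show "w (a + i) \<noteq> 0 \<and> w (a + Suc (Suc i)) = - w (a + i)"
      using assms(6)[of "a + i"] by simp
  next
    fix i assume "i < b - a" "w (a + i) \<noteq> 0"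
    then show "w (a + Suc i) \<noteq> - w (a + i)"
      using assms(4)[of "a + i"] by simp
  next
    fix i assume "i \<le> b - a"
    then show "w (a + i) \<in> {- 1, 0, 1}"
      using assms(5)[of "a + i"] assms(1) by simp
  qed (use assms(1-3) in simp_all)
  ultimately show ?thesis
    using assms(1) by simp
qed

text \<open>
  Once a sign \<open>s\<close> prevails in this sense, no cell can be completed any more, and at either end
  of the board at least two of the three strands will carry the sign \<open>s\<close> next to that end. In a
  terminal position every unmarked inner edge of a strand sits at a change of sign, and an end
  vertex has an unmarked edge exactly if its three strands agree there; counting both makes
  the number of unmarked edges even, so the outcome no longer depends on the moves.
\<close>
definition locked :: "nat \<Rightarrow> int \<Rightarrow> marking \<Rightarrow> bool" where
  "locked k s f \<longleftrightarrow> s \<in> {1, -1} \<and> (f Mid 0 = s \<or> f Mid 1 = s) \<and> (\<exists>i<3. f Up i = s) \<and> (\<exists>i<k. f Low i = s) \<and>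
     (f Up 0 = s \<or> f Up 1 = s \<or> f Low 0 = s \<or> f Low 1 = s) \<and>
     (f Up 2 = s \<or> f Up 1 = s \<or> f Low (k - 1) = s \<or> f Low (k - 2) = s)"

lemma locked_upd:
  assumes "locked k s f" "f p i = 0"
  shows "locked k s (upd f p i t)"
proof -
  have "s \<noteq> 0" using assms(1) by (auto simp: locked_def)
  then have mono: "upd f p i t q j = s" if "f q j = s" for q j
    using assms(2) that by (auto simp: upd_apply)
  show ?thesis
    using assms(1) mono unfolding locked_def by blast
qed

lemma locked_not_cell:
  assumes "locked k s f"
  shows "\<not> cell k f"
proof
  assume "cell k f"
  then obtain t p where t: "t \<in> {1,-1}" "p \<in> {Up, Low}" "\<forall>i<len k p. f p i = t" "\<forall>i<2. f Mid i = - t"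
    unfolding cell_def by blast
  have "\<exists>i<len k p. f p i = s" using assms t(2) by (auto simp: locked_def)
  then have "t = s" using t(3) by auto
  moreover have "f Mid 0 = - t" "f Mid 1 = - t" using t(4) by auto
  moreover have "f Mid 0 = s \<or> f Mid 1 = s" using assms by (simp add: locked_def)
  ultimately show False using t(1) by auto
qed

text \<open>Both directions are illegal, each because some neighbour is directed against it. One
  neighbour cannot block both directions, so both are marked, with opposite signs.\<close>

lemma stuck_inner:
  assumes v: "valid k f" and stuck: "\<And>p i s. \<not> move k f p i s"
    and "0 < i" "Suc i < len k p" "f p i = 0"
  shows "f p (i - 1) \<noteq> 0" "f p (Suc i) = - f p (i - 1)"
proof -
  have "f p (i - 1) = - s \<or> f p (Suc i) = - s" if "s \<in> {1,-1}" for s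
    using moveI[OF v _ _ that, of i p] stuck assms(3-) by auto
  from this[of 1] this[of "-1"] show "f p (i - 1) \<noteq> 0" "f p (Suc i) = - f p (i - 1)"
    by auto
qed

lemma stuck_left:
  assumes v: "valid k f" and stuck: "\<And>p i s. \<not> move k f p i s"
    and "1 < len k p" "f p 0 = 0" "s \<in> {1,-1}"
  shows "f p 1 = - s \<or> (\<forall>q. q \<noteq> p \<longrightarrow> f q 0 = s)"
  using moveI[OF v _ _ assms(5), of 0 p] stuck assms(3-) by auto

lemma stuck_right:
  assumes v: "valid k f" and stuck: "\<And>p i s. \<not> move k f p i s"
    and "1 < len k p" "f p (len k p - 1) = 0" "s \<in> {1,-1}"
  shows "f p (len k p - 2) = - s \<or> (\<forall>q. q \<noteq> p \<longrightarrow> f q (len k q - 1) = s)"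
proof -
  have "len k p - 1 - 1 = len k p - 2" by simp
  then show ?thesis
    using moveI[OF v _ _ assms(5), of "len k p - 1" p] stuck assms(3-) by (auto simp del: diff_diff_left)
qed

lemma card_less_Suc_Collect:
  "card {i. i < Suc n \<and> P i} = card {i. i < n \<and> P i} + of_bool (P n)"
proof -
  have "{i. i < Suc n \<and> P i} = (if P n then insert n {i. i < n \<and> P i} else {i. i < n \<and> P i})"
    by (auto simp: less_Suc_eq)
  then show ?thesis by simp
qed

text \<open>Here \<open>u\<close>, \<open>m\<close>, \<open>l\<close> are the edges at one end of
  the three strands and the primed letters their neighbours; \<open>x\<close> and \<open>y\<close>
  replace an unmarked outer end edge by its neighbour. Exactly two of the end edges carry
  \<open>s\<close>. If the third is marked, it is an outer one with sign \<open>- s\<close>, and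
  only one of \<open>x\<close>, \<open>y\<close> is \<open>s\<close>; if it is unmarked, then
  \<open>x = s\<close> and \<open>y = s\<close>.\<close>

lemma end_parity:
  fixes u u' m m' l l' s :: int
  assumes vals: "u \<in> {-1, 0, 1}" "m \<in> {-1, 0, 1}" "l \<in> {-1, 0, 1}"
    and "s \<in> {1, -1}" "m = s \<or> m' = s" "u = s \<or> u' = s \<or> l = s \<or> l' = s"
    and "u \<noteq> 0 \<longrightarrow> u' \<noteq> - u" "m \<noteq> 0 \<longrightarrow> m' \<noteq> - m" "l \<noteq> 0 \<longrightarrow> l' \<noteq> - l"
    and "\<not> (u = s \<and> m = s \<and> l = s)"
    and "\<And>t. t \<in> {1, -1} \<Longrightarrow> u = 0 \<Longrightarrow> u' = - t \<or> m = t \<and> l = t"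
    and "\<And>t. t \<in> {1, -1} \<Longrightarrow> m = 0 \<Longrightarrow> m' = - t \<or> u = t \<and> l = t"
    and "\<And>t. t \<in> {1, -1} \<Longrightarrow> l = 0 \<Longrightarrow> l' = - t \<or> u = t \<and> m = t"
  defines "x \<equiv> if u = 0 then u' else u" and "y \<equiv> if l = 0 then l' else l"
  shows "even (of_bool (u = 0) + of_bool (m = 0) + of_bool (l = 0) :: nat) \<longleftrightarrow> (x = s) \<noteq> (y = s)"
proof -
  have "- s \<in> {1, -1}" using assms(4) by auto
  note t = assms(11,12,13)[OF assms(4)] assms(11,12,13)[OF this]
  have "((u = 0) \<noteq> (m = 0)) \<noteq> (l = 0) \<longleftrightarrow> (x = s) = (y = s)"
    using assms(1-10) t unfolding x_def y_def insert_iff empty_iff minus_minus by (smt (z3))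
  then show ?thesis by (auto simp: of_bool_def split: if_splits)
qed

lemma locked_stuck:
  assumes k: "3 \<le> k" and v: "valid k f" and stuck: "\<And>p i s. \<not> move k f p i s"
    and l: "locked k s f"
  shows "even (zeros k f)"
proof -
  \<comment> \<open>In a stuck position an unmarked end edge has a marked neighbour, so
    \<open>a\<close> and \<open>b\<close> are the first and the last marked edge of the lower path,
    and \<open>a\<close> and \<open>k - 1 - b\<close> count the unmarked edges outside them.\<close>
  define a where "a = (if f Low 0 = 0 then 1 else 0 :: nat)"
  define b where "b = (if f Low (k - 1) = 0 then k - 2 else k - 1)"
  note L = stuck_left[OF v stuck] and R = stuck_right[OF v stuck] and I = stuck_inner[OF v stuck]
  have vals: "f p i \<in> {-1,0,1}" if "i < len k p" for p i
    using v that by (simp add: valid_def)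
  have adj: "f p (Suc i) \<noteq> - f p i" if "Suc i < len k p" "f p i \<noteq> 0" for p i
    using v that by (simp add: valid_def)
  have alls: "(\<forall>q. q \<noteq> Up \<longrightarrow> P q) = (P Mid \<and> P Low)"  "(\<forall>q. q \<noteq> Mid \<longrightarrow> P q) = (P Up \<and> P Low)"  "(\<forall>q. q \<noteq> Low \<longrightarrow> P q) = (P Up \<and> P Mid)" for P
    by (auto simp: strand_all)
  have left: "f Up 0 = 0 \<Longrightarrow> t \<in> {1,-1} \<Longrightarrow> f Up 1 = - t \<or> f Mid 0 = t \<and> f Low 0 = t"
    "f Mid 0 = 0 \<Longrightarrow> t \<in> {1,-1} \<Longrightarrow> f Mid 1 = - t \<or> f Up 0 = t \<and> f Low 0 = t"
    "f Low 0 = 0 \<Longrightarrow> t \<in> {1,-1} \<Longrightarrow> f Low 1 = - t \<or> f Up 0 = t \<and> f Mid 0 = t" for t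
    using L[of Up t, unfolded alls] L[of Mid t, unfolded alls] L[of Low t, unfolded alls] k by simp_all
  have right: "f Up 2 = 0 \<Longrightarrow> t \<in> {1,-1} \<Longrightarrow> f Up 1 = - t \<or> f Mid 1 = t \<and> f Low (k-1) = t"
    "f Mid 1 = 0 \<Longrightarrow> t \<in> {1,-1} \<Longrightarrow> f Mid 0 = - t \<or> f Up 2 = t \<and> f Low (k-1) = t"
    "f Low (k-1) = 0 \<Longrightarrow> t \<in> {1,-1} \<Longrightarrow> f Low (k-2) = - t \<or> f Up 2 = t \<and> f Mid 1 = t" for t
    using R[of Up t, unfolded alls] R[of Mid t, unfolded alls] R[of Low t, unfolded alls] k by (simp_all add: numeral_eq_Suc)
  have ab: "a \<le> b" using k by (auto simp: a_def b_def)
  have wa: "f Low a \<noteq> 0" using left(3)[of 1] left(3)[of "-1"] by (auto simp: a_def)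
  have wb: "f Low b \<noteq> 0" using right(3)[of 1] right(3)[of "-1"] by (auto simp: b_def)
  have "even (card {i. a \<le> i \<and> i \<le> b \<and> f Low i = 0}) \<longleftrightarrow> f Low b = f Low a"
  proof (rule path_parity_interval[OF ab wa wb])
    fix i assume "a \<le> i" "i < b" "f Low i \<noteq> 0"
    then show "f Low (Suc i) \<noteq> - f Low i" using adj[of i Low] by (auto simp: b_def split: if_splits)
  next
    fix i assume "a \<le> i" "i \<le> b"
    then show "f Low i \<in> {-1,0,1}" using vals[of i Low] k by (auto simp: b_def split: if_splits)
  next
    fix i assume "a \<le> i" "Suc i < b" "f Low (Suc i) = 0"
    then show "f Low i \<noteq> 0 \<and> f Low (Suc (Suc i)) = - f Low i"
      using I[of "Suc i" Low] k by (auto simp: b_def split: if_splits)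
  qed
  note inner = this
  have outer: "card {i. i < k \<and> f Low i = 0} = a + (k - 1 - b) + card {i. a \<le> i \<and> i \<le> b \<and> f Low i = 0}"
  proof -
    have "{i. i < k \<and> f Low i = 0} = {..<a} \<union> {b<..<k} \<union> {i. a \<le> i \<and> i \<le> b \<and> f Low i = 0}"
    proof -
      have "f Low i = 0" if "i < a" for i using that by (auto simp: a_def split: if_splits)
      moreover have "f Low i = 0" if "b < i" "i < k" for i
      proof -
        have "f Low (k - 1) = 0" "i = k - 1" using that k by (auto simp: b_def split: if_splits)
        then show ?thesis by simp
      qed
      moreover have "a < k" "b < k" using k by (auto simp: a_def b_def)
      ultimately show ?thesis by auto
    qed
    moreover have "card ({..<a} \<union> {b<..<k} \<union> {i. a \<le> i \<and> i \<le> b \<and> f Low i = 0})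
      = card ({..<a} \<union> {b<..<k}) + card {i. a \<le> i \<and> i \<le> b \<and> f Low i = 0}"
      using ab by (intro card_Un_disjoint) auto
    moreover have "card ({..<a} \<union> {b<..<k}) = card {..<a} + card {b<..<k}"
      using ab by (intro card_Un_disjoint) auto
    ultimately show ?thesis by simp
  qed
  have low: "even (card {i. i < k \<and> f Low i = 0}) \<longleftrightarrow> even (of_bool (f Low 0 = 0) + of_bool (f Low (k - 1) = 0) + of_bool (f Low b \<noteq> f Low a) :: nat)"
  proof -
    have par: "even a \<longleftrightarrow> f Low 0 \<noteq> 0" "even (k - 1 - b) \<longleftrightarrow> f Low (k - 1) \<noteq> 0"
      using k by (auto simp: a_def b_def)
    show ?thesis
      unfolding outer even_add inner par by simp
  qed
  have s: "s \<in> {1,-1}" using l by (simp add: locked_def)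
  have "a < k" "b < k" using k by (simp_all add: a_def b_def)
  then have AB: "f Low a \<in> {1, -1}" "f Low b \<in> {1, -1}"
    using wa wb vals[of a Low] vals[of b Low] by auto
  have ends: "\<not> (f Up 0 = t \<and> f Mid 0 = t \<and> f Low 0 = t)" "\<not> (f Up 2 = t \<and> f Mid 1 = t \<and> f Low (k-1) = t)" if "t \<in> {1,-1}" for t
  proof -
    have "\<not> (\<forall>p. f p 0 = t)" "\<not> (\<forall>p. f p (len k p - 1) = t)"
      using v that unfolding valid_def by blast+
    then show "\<not> (f Up 0 = t \<and> f Mid 0 = t \<and> f Low 0 = t)" "\<not> (f Up 2 = t \<and> f Mid 1 = t \<and> f Low (k-1) = t)"
      by (simp_all add: strand_all)
  qed
  have e: "Suc 0 = 1" "Suc 1 = 2" "Suc (k - 2) = k - 1" using k by simp_all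
  have lt: "1 < len k Up" "2 < len k Up" "1 < len k Mid" "1 < len k Low" "k - 1 < len k Low" using k by simp_all
  have u1: "f Up 1 = 0 \<longrightarrow> f Up 0 \<noteq> 0 \<and> f Up 2 = - f Up 0"
    using I[of 1 Up, unfolded e, OF _ lt(2)] by simp
  have u2: "f Up 0 \<noteq> 0 \<longrightarrow> f Up 1 \<noteq> - f Up 0" "f Up 1 \<noteq> 0 \<longrightarrow> f Up 2 \<noteq> - f Up 1"
      "f Mid 0 \<noteq> 0 \<longrightarrow> f Mid 1 \<noteq> - f Mid 0"
    using adj[of 0 Up, unfolded e, OF lt(1)] adj[of 1 Up, unfolded e, OF lt(2)]
      adj[of 0 Mid, unfolded e, OF lt(3)] by blast+
  have l2: "f Low 0 \<noteq> 0 \<longrightarrow> f Low 1 \<noteq> - f Low 0" "f Low (k - 2) \<noteq> 0 \<longrightarrow> f Low (k - 1) \<noteq> - f Low (k - 2)"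
    using adj[of 0 Low, unfolded e, OF lt(4)] adj[of "k - 2" Low, unfolded e, OF lt(5)] by blast+
  have l: "f Mid 0 = s \<or> f Mid 1 = s" "f Up 0 = s \<or> f Up 1 = s \<or> f Low 0 = s \<or> f Low 1 = s"
     "f Up 2 = s \<or> f Up 1 = s \<or> f Low (k - 1) = s \<or> f Low (k - 2) = s"
    using l by (auto simp: locked_def)
  define x where "x = (if f Up 0 = 0 then f Up 1 else f Up 0)"
  define y where "y = (if f Up 2 = 0 then f Up 1 else f Up 2)"
  have "f Up 1 \<noteq> 0" if "f Up 0 = 0 \<or> f Up 2 = 0"
    using u1 that by auto
  then have "x \<noteq> 0" "y \<noteq> 0"
    by (auto simp: x_def y_def)
  moreover have "x \<in> {-1, 0, 1}" "y \<in> {-1, 0, 1}"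
    using vals[OF lt(1)] vals[OF lt(2)] vals[of 0 Up] by (auto simp: x_def y_def)
  ultimately have xy: "x \<in> {1, -1}" "y \<in> {1, -1}"
    by auto
  have v0: "f Up 0 \<in> {-1, 0, 1}" "f Mid 0 \<in> {-1, 0, 1}" "f Low 0 \<in> {-1, 0, 1}"
    using k by (intro vals; simp)+
  have v1: "f Up 2 \<in> {-1, 0, 1}" "f Mid 1 \<in> {-1, 0, 1}" "f Low (k - 1) \<in> {-1, 0, 1}"
    using k by (intro vals; simp)+
  have l1: "f Mid 1 = s \<or> f Mid 0 = s" using l(1) by blast
  have al: "(if f Low 0 = 0 then f Low 1 else f Low 0) = f Low a" by (simp add: a_def)
  have bl: "(if f Low (k-1) = 0 then f Low (k-2) else f Low (k-1)) = f Low b" by (simp add: b_def)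
  have zl: "even (of_bool (f Up 0 = 0) + of_bool (f Mid 0 = 0) + of_bool (f Low 0 = 0) :: nat) \<longleftrightarrow> (x = s) \<noteq> (f Low a = s)"
    unfolding x_def al[symmetric]
    by (rule end_parity[OF v0 s l(1,2) u2(1,3) l2(1) ends(1)[OF s]]) (rule left; assumption)+
  have u2': "f Up 2 \<noteq> 0 \<longrightarrow> f Up 1 \<noteq> - f Up 2" "f Mid 1 \<noteq> 0 \<longrightarrow> f Mid 0 \<noteq> - f Mid 1" "f Low (k-1) \<noteq> 0 \<longrightarrow> f Low (k-2) \<noteq> - f Low (k-1)"
    using u2 l2 by auto
  have zr: "even (of_bool (f Up 2 = 0) + of_bool (f Mid 1 = 0) + of_bool (f Low (k-1) = 0) :: nat) \<longleftrightarrow> (y = s) \<noteq> (f Low b = s)"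
    unfolding y_def bl[symmetric]
    by (rule end_parity[OF v1 s l1 l(3) u2' ends(2)[OF s]]) (rule right; assumption)+
  \<comment> \<open>The upper counterpart of \<open>inner\<close>: the only inner edge of the upper
    path is unmarked exactly if the sign changes there.\<close>
  have "x = y \<longleftrightarrow> f Up 1 \<noteq> 0"
  proof (cases "f Up 1 = 0")
    case True
    with u1 show ?thesis by (auto simp: x_def y_def)
  next
    case False
    then have "f Up 1 \<in> {1, -1}" "f Up 0 \<in> {0, f Up 1}" "f Up 2 \<in> {0, f Up 1}"
      using u2 vals[OF lt(1)] vals[OF lt(2)] vals[of 0 Up] by auto
    with False show ?thesis by (auto simp: x_def y_def)
  qed
  then have zu: "even (of_bool (f Up 1 = 0) :: nat) \<longleftrightarrow> (x = s) = (y = s)"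
    using xy s by auto
  have "card {i. i < 3 \<and> f Up i = 0} = of_bool (f Up 0 = 0) + of_bool (f Up 1 = 0) + of_bool (f Up 2 = 0)"
    "card {i. i < 2 \<and> f Mid i = 0} = of_bool (f Mid 0 = 0) + of_bool (f Mid 1 = 0)"
    unfolding numeral_3_eq_3 numeral_2_eq_2 card_less_Suc_Collect by simp_all
  moreover have "(f Low b = f Low a) \<longleftrightarrow> (f Low a = s) = (f Low b = s)"
    using AB s by auto
  moreover have "even (of_bool P :: nat) \<longleftrightarrow> \<not> P" for P by simp
  \<comment> \<open>Modulo 2, each of the tests \<open>x = s\<close>, \<open>y = s\<close>,
    \<open>f Low a = s\<close> and \<open>f Low b = s\<close> enters exactly two of the parities
    \<open>zl\<close>, \<open>zr\<close>, \<open>zu\<close> and \<open>low\<close>, so all of them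
    cancel.\<close>
  ultimately show ?thesis
    using zl zr zu low unfolding zeros_def by (simp only: even_add) argo
qed

text \<open>After a move of the opponent an odd number of edges is unmarked, so the position is not
  stuck. Any legal reply will do, since a lock cannot be undone.\<close>

lemma good_locked:
  assumes k: "3 \<le> k" and f: "pos k f" "locked k s f"
  shows "good k f"
proof (rule class_good[of k "locked k s"])
  fix f p i t assume f: "pos k f" "locked k s f" and m: "move k f p i t"
  let ?g = "upd f p i t"
  have g: "valid k ?g" "locked k s ?g"
    using f m valid_move[OF m] locked_upd[of k s f p i t] by (auto simp: move_def)
  moreover have "odd (zeros k ?g)"
    using f zeros_move[OF m] unfolding pos_def by (metis even_Suc)
  ultimately obtain q j t' where m': "move k ?g q j t'"
    using locked_stuck[OF k g(1) _ g(2)] by blast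
  then have "reply k (locked k s) ?g"
    using locked_upd[OF g(2), of q j t'] by (intro replyI) (auto simp: move_def)
  then show "\<not> cell k ?g \<and> reply k (locked k s) ?g"
    using locked_not_cell[OF g(2)] by simp
qed (use f in auto)

section \<open>The mirror strategy\<close>

lemma moveD:
  assumes "move k f p i s"
  shows "i < len k p" "f p i = 0" "s \<in> {1, -1}" "valid k (upd f p i s)"
    and "0 < i \<Longrightarrow> f p (i - 1) \<noteq> - s" "Suc i < len k p \<Longrightarrow> f p (Suc i) \<noteq> - s"
    and "i = 0 \<Longrightarrow> \<exists>q. q \<noteq> p \<and> f q 0 \<noteq> s"
    and "Suc i = len k p \<Longrightarrow> \<exists>q. q \<noteq> p \<and> f q (len k q - 1) \<noteq> s"
proof -
  let ?g = "upd f p i s"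
  show i: "i < len k p" and s: "s \<in> {1, -1}" and "f p i = 0" and v: "valid k ?g"
    using assms by (auto simp: move_def)
  from s have s0: "s \<noteq> 0" by auto
  have adj: "?g q (Suc j) \<noteq> - ?g q j" if "Suc j < len k q" "?g q j \<noteq> 0" for q j
    using v that by (simp add: valid_def)
  have ends: "\<not> (\<forall>p. ?g p 0 = s)" "\<not> (\<forall>p. ?g p (len k p - 1) = s)"
    using v s unfolding valid_def by blast+
  show "f p (i - 1) \<noteq> - s" if "0 < i"
  proof -
    have "Suc (i - 1) = i" "i - 1 \<noteq> i" using that by auto
    with adj[of "i - 1" p] i s0 show ?thesis by (auto simp: upd_apply)
  qed
  show "f p (Suc i) \<noteq> - s" if "Suc i < len k p"
    using adj[of i p] that s0 by (auto simp: upd_apply split: if_splits)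
  show "\<exists>q. q \<noteq> p \<and> f q 0 \<noteq> s" if "i = 0"
    using ends(1) that by (metis upd_apply)
  show "\<exists>q. q \<noteq> p \<and> f q (len k q - 1) \<noteq> s" if "Suc i = len k p"
    using ends(2) that by (metis upd_apply diff_Suc_1)
qed

text \<open>Along the strand the reply meets the mirror images of the neighbours of the first move,
  so it is as legal as that move. At the opposite end vertex the other strands need not be
  symmetric, hence the assumptions \<open>left\<close> and \<open>right\<close>.\<close>

lemma mirror_move:
  assumes m: "move k f p i s" and sym: "\<And>j. j < len k p \<Longrightarrow> f p (len k p - 1 - j) = f p j"
    and centre: "len k p \<noteq> Suc (2 * i)"
    and left: "Suc i = len k p \<Longrightarrow> \<exists>q. q \<noteq> p \<and> f q 0 \<noteq> s"
    and right: "i = 0 \<Longrightarrow> \<exists>q. q \<noteq> p \<and> f q (len k q - 1) \<noteq> s"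
  shows "move k (upd f p i s) p (len k p - 1 - i) s"
proof (rule moveI)
  note D = moveD[OF m]
  define j where "j = len k p - 1 - i"
  have j: "j < len k p" "j \<noteq> i" "len k p - 1 - j = i" using D(1) centre by (auto simp: j_def)
  show "valid k (upd f p i s)" "s \<in> {1, -1}" by (fact D)+
  show "len k p - 1 - i < len k p" using D(1) by simp
  show "upd f p i s p (len k p - 1 - i) = 0"
    using sym[OF D(1)] D(2) j(2) unfolding j_def by (simp add: upd_apply)
  have s: "s \<noteq> - s" using D(3) by auto
  show "upd f p i s p (len k p - 1 - i - 1) \<noteq> - s" if "0 < len k p - 1 - i"
  proof -
    have "len k p - 1 - Suc i = len k p - 1 - i - 1" using D(1) by simp
    then show ?thesis using sym[of "Suc i"] D(6) that s by (auto simp: upd_apply)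
  qed
  show "upd f p i s p (Suc (len k p - 1 - i)) \<noteq> - s" if "Suc (len k p - 1 - i) < len k p"
  proof -
    have "len k p - 1 - (i - 1) = Suc (len k p - 1 - i)" "0 < i" using D(1) that by auto
    then show ?thesis using sym[of "i - 1"] D(1,5) s by (auto simp: upd_apply)
  qed
  show "\<exists>q. q \<noteq> p \<and> upd f p i s q 0 \<noteq> s" if "len k p - 1 - i = 0"
    using left that D(1) by (auto simp: upd_apply)
  show "\<exists>q. q \<noteq> p \<and> upd f p i s q (len k q - 1) \<noteq> s" if "Suc (len k p - 1 - i) = len k p"
  proof -
    have "i = 0" using that D(1) by simp
    with right show ?thesis by (metis upd_apply)
  qed
qed

text \<open>An edge with \<open>len k p = Suc (2 * i)\<close> is its own mirror image; such edges
  have to be marked so that the unmarked ones fall into pairs.\<close>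

definition mirrored :: "nat \<Rightarrow> marking \<Rightarrow> bool" where
  "mirrored k f \<longleftrightarrow> refl k f = f \<and> (\<forall>p i. len k p = Suc (2 * i) \<longrightarrow> f p i \<noteq> 0) \<and> \<not> cell k f"

lemma refl_eqD: "refl k f = f \<Longrightarrow> j < len k p \<Longrightarrow> f p (len k p - 1 - j) = f p j"
  by (metis refl_def)

lemma good_mirrored:
  assumes k: "2 \<le> k" and f: "pos k f" "mirrored k f"
  shows "good k f"
proof (rule class_good[of k "mirrored k"])
  fix f p i s assume f: "pos k f" "mirrored k f" and m: "move k f p i s"
  note D = moveD[OF m]
  let ?g = "upd f p i s" and ?j = "len k p - 1 - i"
  have sym: "refl k f = f" and nc: "\<not> cell k f" and c: "len k p \<noteq> Suc (2 * i)"
    using f(2) D(2) by (auto simp: mirrored_def)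
  have pos: "0 < len k q" for q using k by (cases q) auto
  have ends: "f q (len k q - 1) = f q 0" for q
    using refl_eqD[OF sym, of 0 q] pos by simp
  have m': "move k ?g p ?j s"
  proof (rule mirror_move[OF m _ c])
    show "\<exists>q. q \<noteq> p \<and> f q 0 \<noteq> s" if "Suc i = len k p"
      using D(8) that by (simp only: ends)
    show "\<exists>q. q \<noteq> p \<and> f q (len k q - 1) \<noteq> s" if "i = 0"
      using D(7) that by (simp only: ends)
  qed (use refl_eqD[OF sym] in auto)
  have j: "?j < len k p" "?j \<noteq> i" "len k p - 1 - ?j = i" using D(1) c by auto
  have "refl k (upd ?g p ?j s) = upd ?g p ?j s"
    unfolding refl_upd[OF j(1)] refl_upd[OF D(1)] sym j(3) using j(2) by (auto simp: fun_eq_iff upd_apply)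
  then have "reply k (mirrored k) ?g"
    using f(2) D(3) m' unfolding reply_def Let_def mirrored_def
    by (intro exI[of _ p] exI[of _ ?j] exI[of _ s]) (auto simp: upd_apply)
  moreover have "\<not> cell k ?g"
  proof
    assume "cell k ?g"
    then obtain t q where t: "t \<in> {1, -1}" "q \<in> {Up, Low}" "\<forall>i<len k q. ?g q i = t" "\<forall>i<2. ?g Mid i = - t"
      unfolding cell_def by blast
    \<comment> \<open>If the move lies on the completed cell, so does its mirror image, which is
      still unmarked; otherwise the cell was complete before the move.\<close>
    show False
    proof (cases "p = q \<or> p = Mid")
      case True
      then have "?g p ?j \<noteq> 0" using t j(1) by auto
      then show False using j(2) refl_eqD[OF sym D(1)] D(2) by (simp add: upd_apply)
    next
      case False
      then have "cell k f" using t unfolding cell_def by (metis upd_apply)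
      with nc show False ..
    qed
  qed
  ultimately show "\<not> cell k ?g \<and> reply k (mirrored k) ?g" by simp
qed (use f in auto)

lemma ex_strand:
  "(\<exists>q. q \<noteq> Up \<and> P q) \<longleftrightarrow> P Mid \<or> P Low"
  "(\<exists>q. q \<noteq> Mid \<and> P q) \<longleftrightarrow> P Up \<or> P Low"
  "(\<exists>q. q \<noteq> Low \<and> P q) \<longleftrightarrow> P Up \<or> P Mid"
  by (metis strand.distinct strand.exhaust)+

lemma less3: "(i::nat) < 3 \<longleftrightarrow> i = 0 \<or> i = 1 \<or> i = 2"
  by auto

lemma less2: "(i::nat) < 2 \<longleftrightarrow> i = 0 \<or> i = 1"
  by auto

lemma cell_iff: "cell k f \<longleftrightarrow> f Mid 0 \<in> {1, -1} \<and> f Mid 1 = f Mid 0 \<and>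
   (f Up 0 = - f Mid 0 \<and> f Up 1 = - f Mid 0 \<and> f Up 2 = - f Mid 0 \<or> (\<forall>i<k. f Low i = - f Mid 0))"
proof
  assume "cell k f"
  then obtain t q where t: "t \<in> {1, -1}" "q \<in> {Up, Low}" "\<forall>i<len k q. f q i = t" "\<forall>i<2. f Mid i = - t"
    unfolding cell_def by blast
  then have "f Mid 0 = - t" "f Mid 1 = - t" by auto
  with t show "f Mid 0 \<in> {1, -1} \<and> f Mid 1 = f Mid 0 \<and>
   (f Up 0 = - f Mid 0 \<and> f Up 1 = - f Mid 0 \<and> f Up 2 = - f Mid 0 \<or> (\<forall>i<k. f Low i = - f Mid 0))"
    by auto
next
  assume r: "f Mid 0 \<in> {1, -1} \<and> f Mid 1 = f Mid 0 \<and>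
   (f Up 0 = - f Mid 0 \<and> f Up 1 = - f Mid 0 \<and> f Up 2 = - f Mid 0 \<or> (\<forall>i<k. f Low i = - f Mid 0))"
  then have "\<exists>q\<in>{Up, Low}. \<forall>i<len k q. f q i = - f Mid 0"
    by (auto simp: less3)
  moreover have "- f Mid 0 \<in> {1, -1}" "\<forall>i<2. f Mid i = - (- f Mid 0)" using r by (auto simp: less2)
  ultimately show "cell k f" unfolding cell_def by blast
qed

lemma move_Up0: "valid k f \<Longrightarrow> s \<in> {1, -1} \<Longrightarrow> f Up 0 = 0 \<Longrightarrow> f Up 1 \<noteq> - s \<Longrightarrow> f Mid 0 \<noteq> s \<or> f Low 0 \<noteq> s \<Longrightarrow> move k f Up 0 s"
  by (rule moveI) (auto simp: ex_strand)
lemma move_Up1: "valid k f \<Longrightarrow> s \<in> {1, -1} \<Longrightarrow> f Up 1 = 0 \<Longrightarrow> f Up 0 \<noteq> - s \<Longrightarrow> f Up 2 \<noteq> - s \<Longrightarrow> move k f Up 1 s"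
  by (rule moveI) (auto simp: numeral_2_eq_2)
lemma move_Up2: "valid k f \<Longrightarrow> s \<in> {1, -1} \<Longrightarrow> f Up 2 = 0 \<Longrightarrow> f Up 1 \<noteq> - s \<Longrightarrow> f Mid 1 \<noteq> s \<or> f Low (k - 1) \<noteq> s \<Longrightarrow> move k f Up 2 s"
  by (rule moveI) (auto simp: ex_strand)
lemma move_Mid0: "valid k f \<Longrightarrow> s \<in> {1, -1} \<Longrightarrow> f Mid 0 = 0 \<Longrightarrow> f Mid 1 \<noteq> - s \<Longrightarrow> f Up 0 \<noteq> s \<or> f Low 0 \<noteq> s \<Longrightarrow> move k f Mid 0 s"
  by (rule moveI) (auto simp: ex_strand)
lemma move_Mid1: "valid k f \<Longrightarrow> s \<in> {1, -1} \<Longrightarrow> f Mid 1 = 0 \<Longrightarrow> f Mid 0 \<noteq> - s \<Longrightarrow> f Up 2 \<noteq> s \<or> f Low (k - 1) \<noteq> s \<Longrightarrow> move k f Mid 1 s"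
  by (rule moveI) (auto simp: ex_strand)

lemma moveD_end:
  "move k f Up 0 s \<Longrightarrow> f Mid 0 \<noteq> s \<or> f Low 0 \<noteq> s"
  "move k f Up 2 s \<Longrightarrow> f Mid 1 \<noteq> s \<or> f Low (k - 1) \<noteq> s"
  "move k f Mid 0 s \<Longrightarrow> f Up 0 \<noteq> s \<or> f Low 0 \<noteq> s"
  "move k f Mid 1 s \<Longrightarrow> f Up 2 \<noteq> s \<or> f Low (k - 1) \<noteq> s"
  "move k f Low 0 s \<Longrightarrow> f Up 0 \<noteq> s \<or> f Mid 0 \<noteq> s"
  "1 \<le> k \<Longrightarrow> move k f Low (k - 1) s \<Longrightarrow> f Up 2 \<noteq> s \<or> f Mid 1 \<noteq> s"
  using moveD(7)[of k f Up 0 s] moveD(8)[of k f Up 2 s] moveD(7)[of k f Mid 0 s] moveD(8)[of k f Mid 1 s]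
    moveD(7)[of k f Low 0 s] moveD(8)[of k f Low "k - 1" s]
  by (auto simp: ex_strand)

lemma moveD_adj:
  "move k f Up 0 s \<Longrightarrow> f Up 1 \<noteq> - s"
  "move k f Up 1 s \<Longrightarrow> f Up 0 \<noteq> - s \<and> f Up 2 \<noteq> - s"
  "move k f Up 2 s \<Longrightarrow> f Up 1 \<noteq> - s"
  "move k f Mid 0 s \<Longrightarrow> f Mid 1 \<noteq> - s"
  "move k f Mid 1 s \<Longrightarrow> f Mid 0 \<noteq> - s"
  using moveD(6)[of k f Up 0 s] moveD(5,6)[of k f Up 1 s] moveD(5)[of k f Up 2 s] moveD(6)[of k f Mid 0 s] moveD(5)[of k f Mid 1 s]
  by (auto simp: numeral_2_eq_2)

definition palindromic :: "nat \<Rightarrow> (nat \<Rightarrow> int) \<Rightarrow> bool" where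
  "palindromic k w \<longleftrightarrow> (\<forall>i<k. w (k - 1 - i) = w i)"

lemma palindromic_upd:
  "palindromic k w \<Longrightarrow> i < k \<Longrightarrow> palindromic k (w(i := s, k - 1 - i := s))"
  by (auto simp: palindromic_def)

lemma palindromic_centre:
  "palindromic (Suc (2 * c)) w \<Longrightarrow> palindromic (Suc (2 * c)) (w(c := s))"
  by (auto simp: palindromic_def)

lemma zeros_refl: "zeros k (refl k f) = zeros k f"
proof -
  have "card {i. i < n \<and> (if i < n then w (n - 1 - i) else w i) = (0::int)} = card {i. i < n \<and> w i = 0}"
    for n and w :: "nat \<Rightarrow> int"
    by (rule bij_betw_same_card[of "\<lambda>i. n - 1 - i"], rule bij_betw_byWitness[of _ "\<lambda>i. n - 1 - i"]) auto
  then show ?thesis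
    unfolding zeros_def refl_def len.simps by presburger
qed

text \<open>Reduces a move at the right end of the upper path to one at the left end. On the
  reflected side the class is empty because \<open>C\<close> need not be invariant under
  \<open>refl\<close>, while \<open>good\<close> is.\<close>

lemma reply_refl:
  assumes k: "2 \<le> k" and r: "reply k (\<lambda>_. False) (refl k g)"
  shows "reply k C g"
proof -
  obtain q j t where m: "move k (refl k g) q j t"
    and h: "cell k (upd (refl k g) q j t) \<or> (pos k (upd (refl k g) q j t) \<longrightarrow> good k (upd (refl k g) q j t))"
    using r by (auto simp: reply_def Let_def)
  have eq: "upd g q (len k q - 1 - j) t = refl k (upd (refl k g) q j t)"
    using moveD(1)[OF m] by (simp add: refl_upd refl_refl)
  have m': "move k g q (len k q - 1 - j) t"
    using move_refl[OF k m] by (simp add: refl_refl)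
  show ?thesis
  proof (rule replyI[OF m'], unfold eq cell_refl good_refl[OF k])
    assume "pos k (refl k (upd (refl k g) q j t))"
    then have "pos k (upd (refl k g) q j t)"
      by (simp add: pos_def zeros_refl valid_refl[OF k])
    with h show "cell k (upd (refl k g) q j t) \<or> C (refl k (upd (refl k g) q j t)) \<or> good k (upd (refl k g) q j t)"
      by blast
  qed
qed

section \<open>The lower path of odd length\<close>

locale odd_board =
  fixes c k :: nat
  assumes k: "k = Suc (2 * c)" and c: "1 \<le> c"
begin

lemma k3: "3 \<le> k"
  using k c by auto

text \<open>With both central edges marked, mirroring of the whole board takes over. The alternative
  \<open>cell k f\<close> covers a reply that has itself just completed a cell.\<close>

lemma good_symmetric:
  assumes "pos k f" "f Up 0 = f Up 2" "f Mid 0 = f Mid 1" "palindromic k (f Low)"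
    and "f Up 1 \<noteq> 0" "f Low c \<noteq> 0"
  shows "cell k f \<or> good k f"
proof -
  have "refl k f p i = f p i" for p i
    using assms(2-4) by (cases p) (auto simp: refl_def palindromic_def less3 less2)
  then have "refl k f = f" by (simp add: fun_eq_iff)
  moreover have "f p i \<noteq> 0" if "len k p = Suc (2 * i)" for p i
    using that assms(5,6) k by (cases p) auto
  ultimately show ?thesis
    using good_mirrored[OF _ assms(1)] k3 by (auto simp: mirrored_def)
qed

lemma low_mirror_move:
  assumes m: "move k f Low i s" and "palindromic k (f Low)" "i \<noteq> c"
    and "i = k - 1 \<Longrightarrow> f Up 0 \<noteq> s \<or> f Mid 0 \<noteq> s" "i = 0 \<Longrightarrow> f Up 2 \<noteq> s \<or> f Mid 1 \<noteq> s"
  shows "move k (upd f Low i s) Low (k - 1 - i) s"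
  using mirror_move[OF m] assms(2-) k by (simp add: palindromic_def ex_strand)

lemma centre_move:
  assumes "valid k f" "palindromic k (f Low)" "f Low c = 0" "s \<in> {1, -1}" "f Low (c - 1) \<noteq> - s"
  shows "move k f Low c s"
proof (rule moveI)
  have "k - 1 - (c - 1) = Suc c" "c - 1 < k" using k c by auto
  then have "f Low (Suc c) = f Low (c - 1)"
    using assms(2) unfolding palindromic_def by metis
  then show "f Low (Suc c) \<noteq> - s" using assms(5) by simp
qed (use assms k c in auto)

text \<open>The two neighbours of the central edge agree by symmetry, so together they cannot block
  both directions.\<close>

lemma centre_move_ex:
  assumes "valid k f" "palindromic k (f Low)" "f Low c = 0"
  obtains s where "s \<in> {1, -1}" "move k f Low c s"
proof (cases "f Low (c - 1) = -1")
  case True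
  then show thesis using centre_move[OF assms, of "-1"] that[of "-1"] by simp
next
  case False
  then show thesis using centre_move[OF assms, of 1] that[of 1] by simp
qed

lemma pal_mirror:
  "palindromic k (f Low) \<Longrightarrow> i < k \<Longrightarrow> palindromic k (upd (upd f Low i s) Low (k - 1 - i) s Low)"
  using palindromic_upd[of k "f Low" i s] by (simp add: upd_def)

lemma pal_centre: "palindromic k (f Low) \<Longrightarrow> palindromic k (upd f Low c s Low)"
  using palindromic_centre[of c "f Low" s] k by (simp add: upd_def)

lemma pal_other: "q \<noteq> Low \<Longrightarrow> palindromic k (upd f q i s Low) \<longleftrightarrow> palindromic k (f Low)"
  by (simp add: upd_def)

text \<open>
  Whoever marks one of the two missing edges of the upper cell lets the opponent complete it; the
  lower cell is blocked, and the rest of the board is paired off.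
\<close>

definition zugzwang :: "int \<Rightarrow> marking \<Rightarrow> bool" where
  "zugzwang s f \<longleftrightarrow> s \<in> {1, -1} \<and> f Up 0 = s \<and> f Up 1 = s \<and> f Up 2 = 0 \<and>
     (f Mid 0 = - s \<and> f Mid 1 = 0 \<or> f Mid 0 = 0 \<and> f Mid 1 = - s) \<and>
     palindromic k (f Low) \<and> f Low c \<noteq> 0 \<and> (\<exists>i<k. f Low i = - s)"

lemma good_zugzwang:
  assumes "pos k f" "zugzwang s f"
  shows "good k f"
proof (rule class_good[of k "zugzwang s"])
  fix f p i t assume f: "pos k f" "zugzwang s f" and m: "move k f p i t"
  note D = moveD[OF m]
  let ?g = "upd f p i t"
  have Z: "s \<in> {1, -1}" "f Up 0 = s" "f Up 1 = s" "f Up 2 = 0"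
     "f Mid 0 = - s \<and> f Mid 1 = 0 \<or> f Mid 0 = 0 \<and> f Mid 1 = - s"
     "palindromic k (f Low)" "f Low c \<noteq> 0" "\<exists>i<k. f Low i = - s"
    using f(2) unfolding zugzwang_def by blast+
  have s0: "s \<noteq> 0" "s \<noteq> - s" using Z(1) by auto
  obtain l where l: "l < k" "f Low l = - s" using Z(8) by blast
  show "\<not> cell k ?g \<and> reply k (zugzwang s) ?g"
  proof (cases p)
    case Up
    have i: "i = 2" using D(1,2) Z(2,3) s0 Up by (auto simp: less3)
    have t: "t = s" using moveD_adj(3)[of k f t] m D(3) Z(1,3) unfolding Up i by auto
    have nc: "\<not> cell k ?g"
      using Z(5) s0 by (auto simp: cell_iff upd_apply Up)
    have "reply k (zugzwang s) ?g"
    proof (cases "f Mid 0 = 0")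
      case True
      show ?thesis
        by (rule replyI[OF move_Mid0[OF D(4), of "- s"]])
          (use Z s0 True in \<open>auto simp: upd_apply cell_iff Up i t\<close>)
    next
      case False
      show ?thesis
        by (rule replyI[OF move_Mid1[OF D(4), of "- s"]])
          (use Z s0 False in \<open>auto simp: upd_apply cell_iff Up i t\<close>)
    qed
    with nc show ?thesis ..
  next
    case Mid
    have t: "t = - s" using moveD_adj(4,5)[of k f t] m D(1,2,3) Z(1,5) s0 unfolding Mid by (auto simp: less2)
    have "i = 0 \<and> f Mid 1 = - s \<or> i = 1 \<and> f Mid 0 = - s"
    proof -
      have "i = 0 \<or> i = 1" using D(1) Mid by auto
      then show ?thesis using Z(5) D(2) s0(1) unfolding Mid by (elim disjE) simp_all
    qed
    then have mid: "?g Mid 0 = - s" "?g Mid 1 = - s" "\<And>i. ?g Up i = f Up i"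
      by (auto simp: upd_apply Mid t)
    \<comment> \<open>A middle path directed \<open>- s\<close> completes the lower cell only if the
      whole lower path is directed \<open>s\<close>; the mark \<open>- s\<close> at \<open>l\<close>
      prevents this.\<close>
    have "\<not> (\<forall>i<k. ?g Low i = s)"
      using l s0 by (auto simp: upd_apply Mid)
    with mid Z(4) s0 have nc: "\<not> cell k ?g"
      by (simp add: cell_iff)
    from mid have "reply k (zugzwang s) ?g"
      by (intro replyI[OF move_Up2[OF D(4), of s]]) (use Z(1-4) s0 in \<open>auto simp: upd_apply[of ?g] cell_iff\<close>)
    with nc show ?thesis ..
  next
    case Low
    have i: "i < k" "i \<noteq> c" using D(1,2) Z(7) unfolding Low by auto
    have nc: "\<not> cell k ?g"
      using Z(5) s0 by (auto simp: cell_iff upd_apply Low)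
    have m': "move k ?g Low (k - 1 - i) t"
      unfolding Low using moveD_end(5,6)[of k f t] k Z(2-5) s0 D(3)
      by (intro low_mirror_move[OF m[unfolded Low] Z(6) i(2)]) auto
    have lg: "upd ?g Low (k - 1 - i) t Low l = - s"
      using l moveD(2)[OF m'] D(2) s0 by (auto simp: upd_apply Low)
    let ?h = "upd ?g Low (k - 1 - i) t"
    have "?h Up j = f Up j" "?h Mid j = f Mid j" "?h Low c \<noteq> 0" for j
      using Z(7) D(3) by (auto simp: upd_apply Low)
    moreover have "\<exists>i<k. ?h Low i = - s" using l(1) lg by blast
    ultimately have "zugzwang s ?h"
      unfolding zugzwang_def using Z(1-5) pal_mirror[of f i t, OF Z(6) i(1)] unfolding Low by simp
    then have "reply k (zugzwang s) ?g"
      by (intro replyI[OF m']) simp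
    with nc show ?thesis ..
  qed
qed (use assms in auto)

text \<open>The edge \<open>Up 1\<close> is adjacent to both end edges of the upper path, so
  \<open>s\<close> there meets both end conditions of \<open>locked\<close> at once.\<close>

lemma lockedI:
  assumes "s \<in> {1, -1}" "f Mid 0 = s \<or> f Mid 1 = s" "f Up 1 = s" "i < k" "f Low i = s"
  shows "locked k s f"
  using assms unfolding locked_def by (auto intro: exI[of _ 1])

text \<open>Here the opponent's own move has produced the lock. A legal reply exists by parity, and
  every legal reply preserves the lock.\<close>

lemma locked_reply:
  assumes "pos k f" "move k f p i t" "locked k s (upd f p i t)"
  shows "reply k C (upd f p i t)"
proof -
  let ?g = "upd f p i t"
  have v: "valid k ?g" using moveD(4)[OF assms(2)] .
  have odd: "odd (zeros k ?g)"
    using assms(1) zeros_move[OF assms(2)] unfolding pos_def by (metis even_Suc)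
  obtain q j r where m: "move k ?g q j r"
    using locked_stuck[OF k3 v _ assms(3)] odd by blast
  then have "locked k s (upd ?g q j r)"
    using locked_upd[OF assms(3)] moveD(2) by blast
  then show ?thesis
    using good_locked[OF k3] by (intro replyI[OF m]) blast
qed

text \<open>The missing middle edge is paired with the central edge of the lower path.\<close>

definition half :: "int \<Rightarrow> marking \<Rightarrow> bool" where
  "half s f \<longleftrightarrow> s \<in> {1, -1} \<and> f Up 1 = s \<and> f Up 0 = f Up 2 \<and>
     (f Mid 0 = s \<and> f Mid 1 = 0 \<or> f Mid 0 = 0 \<and> f Mid 1 = s) \<and>
     palindromic k (f Low) \<and> f Low c = 0 \<and> (\<forall>i<k. f Low i \<noteq> s)"

text \<open>The missing middle edge and the lower centre answer each other, and other marks are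
  mirrored. The exception is a mark \<open>s\<close> on the lower path off its centre, which locks
  the position at once.\<close>

lemma good_half:
  assumes "pos k f" "half s f"
  shows "good k f"
proof (rule class_good[of k "half s"])
  fix f p i t assume f: "pos k f" "half s f" and m: "move k f p i t"
  note D = moveD[OF m]
  let ?g = "upd f p i t"
  have Z: "s \<in> {1, -1}" "f Up 1 = s" "f Up 0 = f Up 2"
     "f Mid 0 = s \<and> f Mid 1 = 0 \<or> f Mid 0 = 0 \<and> f Mid 1 = s"
     "palindromic k (f Low)" "f Low c = 0" "\<And>i. i < k \<Longrightarrow> f Low i \<noteq> s"
    using f(2) unfolding half_def by blast+
  have s0: "s \<noteq> 0" "s \<noteq> - s" "s = 0 \<longleftrightarrow> False" using Z(1) by auto
  have ck: "c < k" "0 < k" using k by auto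
  have ends: "f Low 0 \<noteq> s" "f Low (k - 1) \<noteq> s" using Z(7) ck by auto
  \<comment> \<open>A middle path completed by this move is directed \<open>s\<close>; then
    \<open>Up 1\<close>, directed \<open>s\<close>, blocks the upper cell, and the lower cell still
    lacks its central edge.\<close>
  have nc: "\<not> cell k ?g"
  proof
    assume "cell k ?g"
    then have cl: "?g Mid 0 \<in> {1, -1}" "?g Mid 1 = ?g Mid 0"
      "?g Up 1 = - ?g Mid 0 \<or> ?g Low c = - ?g Mid 0"
      using ck by (auto simp: cell_iff)
    show False
    proof (cases "p = Mid")
      case True
      have "i = 0 \<or> i = 1" using D(1) True by auto
      then have "?g Mid 0 = s"
        using cl(2) Z(4) s0(1) D(2) unfolding True by (elim disjE) (simp_all add: upd_apply)
      then show False using cl(3) Z(1,2,6) s0 True by (auto simp: upd_apply)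
    next
      case False
      then show False using cl(1,2) Z(4) s0 by (auto simp: upd_apply)
    qed
  qed
  have "reply k (half s) ?g"
  proof (cases p)
    case Up
    have i: "i = 0 \<or> i = 2" using D(1,2) Z(2) s0 Up by (auto simp: less3)
    have t: "t = s" using moveD_adj(1,3)[of k f t] m i D(3) Z(1,2) unfolding Up by auto
    show ?thesis
    proof (cases "i = 0")
      case True
      then have "f Up 2 = 0" using D(2) Z(3) Up by simp
      then show ?thesis
        by (intro replyI[OF move_Up2[OF D(4), of s]])
          (use Z s0 True ends in \<open>auto simp: upd_apply half_def pal_other Up t\<close>)
    next
      case False
      then have "i = 2" "f Up 0 = 0" using i D(2) Z(3) Up by auto
      then show ?thesis
        by (intro replyI[OF move_Up0[OF D(4), of s]])
          (use Z s0 ends in \<open>auto simp: upd_apply half_def pal_other Up t\<close>)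
    qed
  next
    case Mid
    have t: "t = s" using moveD_adj(4,5)[of k f t] m D(1,2,3) Z(1,4) s0 unfolding Mid by (auto simp: less2)
    have "i = 0 \<and> f Mid 1 = s \<or> i = 1 \<and> f Mid 0 = s"
    proof -
      have "i = 0 \<or> i = 1" using D(1) Mid by auto
      then show ?thesis using Z(4) D(2) s0(1) unfolding Mid by (elim disjE) simp_all
    qed
    then have mid: "?g Mid 0 = s" "?g Mid 1 = s" "\<And>i. ?g Up i = f Up i" "\<And>i. ?g Low i = f Low i" "?g Low = f Low"
      by (auto simp: upd_apply Mid t)
    obtain r where r: "r \<in> {1, -1}" "move k ?g Low c r"
      using centre_move_ex[OF D(4)] mid Z(5,6) by metis
    show ?thesis
    proof (rule replyI[OF r(2)])
      assume p: "pos k (upd ?g Low c r)"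
      show "cell k (upd ?g Low c r) \<or> half s (upd ?g Low c r) \<or> good k (upd ?g Low c r)"
        using good_symmetric[OF p] mid Z(2,3,5) s0 r(1) pal_centre[of ?g r]
        by (auto simp: upd_apply[of ?g])
    qed
  next
    case Low
    have i: "i < k" using D(1) Low by auto
    show ?thesis
    proof (cases "i = c")
      case True
      have "\<exists>j. move k ?g Mid j s \<and> (f Mid 0 = s \<and> j = 1 \<or> f Mid 1 = s \<and> j = 0)"
      proof (cases "f Mid 0 = 0")
        case F: True
        then have "move k ?g Mid 0 s"
          using Z(1,4) s0 ends c True by (intro move_Mid0[OF D(4)]) (auto simp: upd_apply Low)
        then show ?thesis using F Z(4) s0 by auto
      next
        case F: False
        have "c \<noteq> k - 1" using k c by simp
        then have "move k ?g Mid 1 s"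
          using Z(1,4) s0 ends c True F by (intro move_Mid1[OF D(4)]) (auto simp: upd_apply Low)
        then show ?thesis using F Z(4) by auto
      qed
      then obtain j where j: "move k ?g Mid j s" "f Mid 0 = s \<and> j = 1 \<or> f Mid 1 = s \<and> j = 0" by blast
      show ?thesis
      proof (rule replyI[OF j(1)])
        assume p: "pos k (upd ?g Mid j s)"
        have "upd ?g Mid j s Mid 0 = s" "upd ?g Mid j s Mid 1 = s"
          using j(2) by (auto simp: upd_apply Low)
        moreover have "palindromic k (upd ?g Mid j s Low)"
          using pal_centre[of f t, OF Z(5)] pal_other[of Mid] unfolding Low True by simp
        moreover have "upd ?g Mid j s Low c \<noteq> 0" "upd ?g Mid j s Up l = f Up l" for l
          using D(3) by (auto simp: upd_apply Low True)
        ultimately show "cell k (upd ?g Mid j s) \<or> half s (upd ?g Mid j s) \<or> good k (upd ?g Mid j s)"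
          using good_symmetric[OF p] Z(2,3) s0(1) by auto
      qed
    next
      case F: False
      show ?thesis
      proof (cases "t = s")
        case True
        have "?g Mid 0 = s \<or> ?g Mid 1 = s" "?g Up 1 = s" "?g Low i = s"
          using Z(2,4) by (auto simp: upd_apply Low True)
        then have "locked k s ?g" using lockedI Z(1) i by blast
        then show ?thesis using locked_reply[OF f(1) m] by blast
      next
        case False
        then have t: "t = - s" using D(3) Z(1) by auto
        have m': "move k ?g Low (k - 1 - i) t"
          using Z(4) s0 unfolding Low t
          by (intro low_mirror_move[OF m[unfolded Low t] Z(5) F]) auto
        from False have "\<And>l. l < k \<Longrightarrow> upd ?g Low (k - 1 - i) t Low l \<noteq> s"
          using Z(7) by (auto simp: upd_apply Low)
        moreover have "upd ?g Low (k - 1 - i) t Low c = 0"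
          using Z(6) F k i by (auto simp: upd_apply Low)
        ultimately have "half s (upd ?g Low (k - 1 - i) t)"
          unfolding half_def using Z(1-4) pal_mirror[of f i t, OF Z(5) i] by (auto simp: upd_apply[of _ Low] Low)
        then show ?thesis
          by (intro replyI[OF m']) simp
      qed
    qed
  qed
  with nc show "\<not> cell k ?g \<and> reply k (half s) ?g" by simp
qed (use assms in auto)

lemma not_cell_Mid: "f Mid 0 = 0 \<or> f Mid 1 = 0 \<Longrightarrow> \<not> cell k f"
  by (auto simp: cell_iff)

text \<open>\<open>Up 2\<close> and the lower centre are partners here. The last conjunct prepares
  for \<open>zugzwang\<close>: either \<open>- s\<close> is already on the lower path, or no
  \<open>s\<close> there prevents marking the centre with \<open>- s\<close>.\<close>

definition lead :: "int \<Rightarrow> marking \<Rightarrow> bool" where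
  "lead s f \<longleftrightarrow> s \<in> {1, -1} \<and> f Up 0 = s \<and> f Up 1 = s \<and> f Up 2 = 0 \<and>
     f Mid 0 = 0 \<and> f Mid 1 = 0 \<and> palindromic k (f Low) \<and> f Low c = 0 \<and>
     ((\<forall>i<k. f Low i \<noteq> s) \<or> (\<exists>i<k. f Low i = - s))"

lemma good_lead:
  assumes "pos k f" "lead s f"
  shows "good k f"
proof (rule class_good[of k "lead s"])
  fix f p i t assume f: "pos k f" "lead s f" and m: "move k f p i t"
  note D = moveD[OF m]
  let ?g = "upd f p i t"
  have Z: "s \<in> {1, -1}" "f Up 0 = s" "f Up 1 = s" "f Up 2 = 0" "f Mid 0 = 0" "f Mid 1 = 0"
     "palindromic k (f Low)" "f Low c = 0" "(\<forall>i<k. f Low i \<noteq> s) \<or> (\<exists>i<k. f Low i = - s)"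
    using f(2) unfolding lead_def by blast+
  have s0: "s \<noteq> 0" "s \<noteq> - s" using Z(1) by auto
  have ck: "c < k" "c \<noteq> k - 1" using k c by auto
  have nc: "\<not> cell k ?g"
    using Z(5,6) by (intro not_cell_Mid) (auto simp: upd_apply)
  have ms: "- s \<in> {1, -1}" using Z(1) by auto
  have "reply k (lead s) ?g"
  proof (cases p)
    case Up
    have i: "i = 2" using D(1,2) Z(2,3) s0 Up by (auto simp: less3)
    have t: "t = s" using moveD_adj(3)[of k f t] m D(3) Z(1,3) unfolding Up i by auto
    have low: "?g Low = f Low" by (simp add: upd_def Up)
    obtain r where r: "r \<in> {1, -1}" "move k ?g Low c r"
      using centre_move_ex[OF D(4)] low Z(7,8) by metis
    show ?thesis
    proof (rule replyI[OF r(2)])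
      assume p: "pos k (upd ?g Low c r)"
      have "palindromic k (upd ?g Low c r Low)"
        using pal_centre[of ?g r] low Z(7) by simp
      then show "cell k (upd ?g Low c r) \<or> lead s (upd ?g Low c r) \<or> good k (upd ?g Low c r)"
        using good_symmetric[OF p] Z(2,3,5,6) s0 r(1) by (auto simp: upd_apply Up i t)
    qed
  next
    case Mid
    have low: "?g Low = f Low" by (simp add: upd_def Mid)
    have i: "i = 0 \<or> i = 1" using D(1) Mid by auto
    show ?thesis
    proof (cases "t = s")
      case t: True
      have mid: "?g Mid 0 = s \<and> ?g Mid 1 = 0 \<or> ?g Mid 0 = 0 \<and> ?g Mid 1 = s"
        using i Z(5,6) by (auto simp: upd_apply Mid t)
      show ?thesis
      proof (cases "\<exists>l<k. f Low l = s")
        case True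
        then obtain l where l: "l < k" "f Low l = s" by blast
        have "locked k s ?g"
          using lockedI[of s ?g l] mid l low Z(1,3) by (auto simp: upd_apply Mid)
        then show ?thesis using locked_reply[OF f(1) m] by blast
      next
        case False
        then have "f Low (k - 1) \<noteq> s" using k by auto
        then have m': "move k ?g Up 2 s"
          using Z(1,3,4) s0 by (intro move_Up2[OF D(4)]) (auto simp: upd_apply Mid)
        \<comment> \<open>With no \<open>s\<close> on the lower path, completing the upper path
          makes the missing middle edge and the lower centre the new partners.\<close>
        have "half s (upd ?g Up 2 s)"
          unfolding half_def using Z(1-3,7,8) False mid by (auto simp: upd_apply pal_other Mid)
        then show ?thesis
          using good_half by (intro replyI[OF m']) blast
      qed
    next
      case False
      then have t: "t = - s" using D(3) Z(1) by auto
      have mid: "?g Mid 0 = - s \<and> ?g Mid 1 = 0 \<or> ?g Mid 0 = 0 \<and> ?g Mid 1 = - s"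
        using i Z(5,6) by (auto simp: upd_apply Mid t)
      \<comment> \<open>The reply on the centre must leave a mark \<open>- s\<close> on the lower
        path: an old one, or the new mark itself.\<close>
      obtain r l where r: "r \<in> {1, -1}" "move k ?g Low c r" and l: "l < k" "upd ?g Low c r Low l = - s"
      proof (cases "\<exists>l<k. f Low l = - s")
        case True
        then obtain l where l: "l < k" "f Low l = - s" by blast
        obtain r where r: "r \<in> {1, -1}" "move k ?g Low c r"
          using centre_move_ex[OF D(4)] low Z(7,8) by metis
        have "l \<noteq> c" using l Z(8) s0 by auto
        then show thesis using that[OF r l(1)] l(2) low by (simp add: upd_apply)
      next
        case False
        moreover have "c - 1 < k" using k by simp
        ultimately have "f Low (c - 1) \<noteq> - (- s)" using Z(9) by auto
        then have "move k ?g Low c (- s)"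
          using centre_move[OF D(4) _ _ ms] low Z(7,8) by simp
        then show thesis using that[OF ms _ ck(1)] by (simp add: upd_apply)
      qed
      let ?h = "upd ?g Low c r"
      have "?h Mid j = ?g Mid j" "?h Up j = f Up j" "?h Low c \<noteq> 0" for j
        using r(1) by (auto simp: upd_apply Mid)
      moreover have "\<exists>i<k. ?h Low i = - s" using l by blast
      moreover have "palindromic k (?h Low)" using pal_centre[of ?g r] Z(7) low by simp
      ultimately have "zugzwang s ?h"
        unfolding zugzwang_def using Z(1-4) mid by simp
      then show ?thesis
        using good_zugzwang by (intro replyI[OF r(2)]) blast
    qed
  next
    case Low
    have i: "i < k" using D(1) Low by auto
    show ?thesis
    proof (cases "i = c")
      case True
      have m': "move k ?g Up 2 s"
        using Z(1,3,4,6) s0 by (intro move_Up2[OF D(4)]) (auto simp: upd_apply Low)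
      show ?thesis
      proof (rule replyI[OF m'])
        assume p: "pos k (upd ?g Up 2 s)"
        have "palindromic k (upd ?g Up 2 s Low)"
          using pal_centre[of f t, OF Z(7)] pal_other[of Up] unfolding Low True by simp
        then show "cell k (upd ?g Up 2 s) \<or> lead s (upd ?g Up 2 s) \<or> good k (upd ?g Up 2 s)"
          using good_symmetric[OF p] Z(2,3,5,6) s0 D(3) by (auto simp: upd_apply Low True)
      qed
    next
      case F: False
      show ?thesis
      proof (cases "\<exists>l<k. ?g Low l = s")
        case True
        then obtain l where l: "l < k" "?g Low l = s" by blast
        \<comment> \<open>With \<open>s\<close> on the lower path, a middle edge directed
          \<open>s\<close> is all that is missing for a lock.\<close>
        have m': "move k ?g Mid 1 s"
          using Z(1,4,5,6) s0 by (intro move_Mid1[OF D(4)]) (auto simp: upd_apply Low)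
        have "locked k s (upd ?g Mid 1 s)"
          using lockedI[of s "upd ?g Mid 1 s" l] Z(1,3) l by (auto simp: upd_apply Low)
        then show ?thesis
          using good_locked[OF k3] by (intro replyI[OF m']) auto
      next
        case False
        then have "?g Low i \<noteq> s" using i by auto
        then have t: "t = - s" using D(3) Z(1) by (auto simp: upd_apply Low)
        have m': "move k ?g Low (k - 1 - i) t"
          using Z(4,5) s0 unfolding Low t
          by (intro low_mirror_move[OF m[unfolded Low t] Z(7) F]) auto
        let ?h = "upd ?g Low (k - 1 - i) t"
        have "?h Low l \<noteq> s" if "l < k" for l
          using False that s0 unfolding t by (auto simp: upd_apply[of "upd f p i (- s)"])
        moreover have "?h Low c = 0" "?h Up j = f Up j" "?h Mid j = f Mid j" for j
          using Z(8) F k i by (auto simp: upd_apply Low)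
        ultimately have "lead s ?h"
          unfolding lead_def using Z(1-6) pal_mirror[of f i t, OF Z(7) i] unfolding Low by simp
        then show ?thesis
          by (intro replyI[OF m']) simp
      qed
    qed
  qed
  with nc show "\<not> cell k ?g \<and> reply k (lead s) ?g" by simp
qed (use assms in auto)

text \<open>Of \<open>locked\<close> only the condition at the right end may be missing, and it can
  be met at \<open>Up 1\<close> as well as at \<open>Low (k - 1)\<close>. One move of the opponent
  cannot prevent both, so the next reply already leaves this class for a lock.\<close>

definition chase :: "int \<Rightarrow> marking \<Rightarrow> bool" where
  "chase s f \<longleftrightarrow> s \<in> {1, -1} \<and> f Up 0 = s \<and> f Up 1 = 0 \<and> f Up 2 = 0 \<and> f Mid 0 = s \<and> f Mid 1 = 0 \<and>
     (\<exists>i<k. f Low i = s) \<and> f Low (k - 1) = 0 \<and> f Low (k - 2) \<noteq> - s"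

lemma good_chase:
  assumes "pos k f" "chase s f"
  shows "good k f"
proof (rule class_good[of k "chase s"])
  fix f p i t assume f: "pos k f" "chase s f" and m: "move k f p i t"
  note D = moveD[OF m]
  let ?g = "upd f p i t"
  have Z: "s \<in> {1, -1}" "f Up 0 = s" "f Up 1 = 0" "f Up 2 = 0" "f Mid 0 = s" "f Mid 1 = 0"
     "f Low (k - 1) = 0" "f Low (k - 2) \<noteq> - s"
    using f(2) unfolding chase_def by blast+
  obtain l where l: "l < k" "f Low l = s"
    using f(2) unfolding chase_def by blast
  have s0: "s \<noteq> 0" "s \<noteq> - s" using Z(1) by auto
  have G: "?g Up 0 = s" "?g Mid 0 = s" "?g Low l = s"
    using Z(2,5) l D(2) s0 by (auto simp: upd_apply)
  have nc: "\<not> cell k ?g"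
    using G l(1) s0 by (auto simp: cell_iff)
  have "reply k (chase s) ?g"
  proof (cases "?g Up 1 = 0")
    case u1: True
    show ?thesis
    proof (cases "?g Up 2 = - s")
      case True
      then have p: "p = Up" using Z(4) s0 by (auto simp: upd_apply split: if_splits)
      \<comment> \<open>The mark \<open>- s\<close> on \<open>Up 2\<close> that blocks
        \<open>Up 1\<close> also ensures that the three strands do not all carry \<open>s\<close> at
        the right end, so this move is legal.\<close>
      have m': "move k ?g Low (k - 1) s"
      proof (rule moveI[OF D(4)])
        have "k - 1 - 1 = k - 2" by simp
        then show "?g Low (k - 1 - 1) \<noteq> - s" using Z(8) by (simp add: upd_apply p)
        show "\<exists>q. q \<noteq> Low \<and> ?g q (len k q - 1) \<noteq> s"
          using True s0 by (auto simp: ex_strand)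
      qed (use Z(1,7) k3 p in \<open>auto simp: upd_apply\<close>)
      let ?h = "upd ?g Low (k - 1) s"
      have "?h Mid 0 = s" "?h Up 0 = s" "?h Low (k - 1) = s" "?h Low l = s"
        using G by (auto simp: upd_apply[of ?g])
      then have "locked k s ?h"
        unfolding locked_def using Z(1) l(1) by (auto intro: exI[of _ 0])
      then show ?thesis
        using good_locked[OF k3] by (intro replyI[OF m']) blast
    next
      case False
      have m': "move k ?g Up 1 s"
        using u1 False G(1) s0 Z(1) by (intro move_Up1[OF D(4)]) auto
      have "locked k s (upd ?g Up 1 s)"
        using lockedI[of s "upd ?g Up 1 s" l] G l(1) Z(1) by (auto simp: upd_apply[of ?g])
      then show ?thesis
        using good_locked[OF k3] by (intro replyI[OF m']) blast
    qed
  next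
    case False
    then have p: "p = Up" "i = 1" using Z(3) by (auto simp: upd_apply split: if_splits)
    have t: "t = s" using moveD_adj(2)[of k f t] m D(3) Z(1,2) unfolding p by auto
    have "locked k s ?g"
      using lockedI[of s ?g l] G l(1) Z(1) by (auto simp: upd_apply p t)
    then show ?thesis using locked_reply[OF f(1) m] by blast
  qed
  with nc show "\<not> cell k ?g \<and> reply k (chase s) ?g" by simp
qed (use assms in auto)

text \<open>The two central edges are partners. Mirroring goes on as long as the opponent stays on
  the lower path off its centre.\<close>

definition upper_open :: "marking \<Rightarrow> bool" where
  "upper_open f \<longleftrightarrow> (\<forall>i. f Up i = 0) \<and> (\<forall>i. f Mid i = 0) \<and> palindromic k (f Low) \<and> f Low c = 0"

text \<open>Extending the mark to \<open>Up 1\<close> works if the side condition of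
  \<open>lead\<close> holds. Otherwise the lower path contains \<open>t\<close> but not
  \<open>- t\<close>, and \<open>t\<close> is made to prevail by a middle edge: at once if the ends
  of the lower path carry \<open>t\<close>, through \<open>chase\<close> if they are
  unmarked.\<close>

lemma reply_upper_open:
  assumes f: "pos k f" "upper_open f" and m: "move k f Up 0 t"
  shows "reply k C (upd f Up 0 t)"
proof -
  note D = moveD[OF m]
  let ?g = "upd f Up 0 t"
  have Z: "\<And>i. f Up i = 0" "\<And>i. f Mid i = 0" "palindromic k (f Low)" "f Low c = 0"
    using f(2) unfolding upper_open_def by blast+
  have t0: "t \<noteq> 0" "t \<noteq> - t" using D(3) by auto
  show ?thesis
  proof (cases "(\<forall>l<k. f Low l \<noteq> t) \<or> (\<exists>l<k. f Low l = - t)")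
    case True
    have m': "move k ?g Up 1 t"
      using Z(1) D(3) t0 by (intro move_Up1[OF D(4)]) (auto simp: upd_apply)
    have "lead t (upd ?g Up 1 t)"
      unfolding lead_def using Z D(3) True by (auto simp: upd_apply pal_other)
    then show ?thesis
      using good_lead by (intro replyI[OF m']) blast
  next
    case False
    then obtain l where l: "l < k" "f Low l = t" and no: "\<And>l. l < k \<Longrightarrow> f Low l \<noteq> - t" by blast
    have "f Low (k - 1 - 0) = f Low 0"
      using Z(3) k3 unfolding palindromic_def by (metis less_le_trans zero_less_numeral)
    then have ends: "f Low (k - 1) = f Low 0" by simp
    show ?thesis
    proof (cases "f Low 0 = t")
      case True
      have m': "move k ?g Mid 1 t"
        using Z(1,2) D(3) t0 by (intro move_Mid1[OF D(4)]) (auto simp: upd_apply)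
      let ?h = "upd ?g Mid 1 t"
      have "?h Mid 1 = t" "?h Up 0 = t" "?h Low (k - 1) = t" "?h Low l = t"
        using True ends l by (auto simp: upd_apply)
      then have "locked k t ?h"
        unfolding locked_def using D(3) l(1) by (auto intro: exI[of _ 0])
      then show ?thesis
        using good_locked[OF k3] by (intro replyI[OF m']) blast
    next
      case F: False
      have "valid k f" using f(1) by (simp add: pos_def)
      then have "f Low 0 \<in> {-1, 0, 1}" using k3 unfolding valid_def by (metis len.simps(3) less_le_trans zero_less_numeral)
      then have low0: "f Low 0 = 0" using no[of 0] F D(3) k3 by auto
      have m': "move k ?g Mid 0 t"
        using Z(1,2) D(3) t0 F by (intro move_Mid0[OF D(4)]) (auto simp: upd_apply)
      have "chase t (upd ?g Mid 0 t)"
        unfolding chase_def using Z(1,2) D(3) l no[of "k - 2"] k3 low0 ends by (auto simp: upd_apply)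
      then show ?thesis
        using good_chase by (intro replyI[OF m']) blast
    qed
  qed
qed

lemma good_upper_open:
  assumes "pos k f" "upper_open f"
  shows "good k f"
proof (rule class_good[of k upper_open])
  fix f p i t assume f: "pos k f" "upper_open f" and m: "move k f p i t"
  note D = moveD[OF m]
  let ?g = "upd f p i t"
  have Z: "\<And>i. f Up i = 0" "\<And>i. f Mid i = 0" "palindromic k (f Low)" "f Low c = 0"
    using f(2) unfolding upper_open_def by blast+
  have t0: "t \<noteq> 0" "t \<noteq> - t" using D(3) by auto
  have nc: "\<not> cell k ?g"
    using Z(2) by (intro not_cell_Mid) (auto simp: upd_apply)
  have "reply k upper_open ?g"
  proof (cases p)
    case Up
    have low: "?g Low = f Low" by (simp add: upd_def Up)
    consider "i = 0" | "i = 1" | "i = 2" using D(1) Up by (auto simp: less3)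
    then show ?thesis
    proof cases
      case 1
      then show ?thesis using reply_upper_open[OF f] m Up by blast
    next
      case 2
      obtain r where r: "r \<in> {1, -1}" "move k ?g Low c r"
        using centre_move_ex[OF D(4)] low Z(3,4) by metis
      show ?thesis
      proof (rule replyI[OF r(2)])
        assume p: "pos k (upd ?g Low c r)"
        have "palindromic k (upd ?g Low c r Low)"
          using pal_centre[of ?g r] low Z(3) by simp
        then show "cell k (upd ?g Low c r) \<or> upper_open (upd ?g Low c r) \<or> good k (upd ?g Low c r)"
          using good_symmetric[OF p] Z(1,2) t0 r(1) by (auto simp: upd_apply Up 2)
      qed
    next
      case 3
      have k2: "2 \<le> k" using k3 by simp
      have "refl k f = f"
      proof -
        have "refl k f q j = f q j" for q j
          using Z(1-3) by (cases q) (auto simp: refl_def palindromic_def)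
        then show ?thesis by (simp add: fun_eq_iff)
      qed
      then have eq: "refl k ?g = upd f Up 0 t" and "move k f Up 0 t"
        using refl_upd[OF D(1), of f t] move_refl[OF k2 m] by (simp_all add: Up 3)
      then show ?thesis
        using reply_refl[OF k2, of ?g] reply_upper_open[OF f] by metis
    qed
  next
    case Mid
    have i: "i = 0 \<or> i = 1" using D(1) Mid by auto
    \<comment> \<open>Together with a middle edge directed \<open>t\<close> the upper cell would
      require \<open>- t\<close> on the whole upper path, so this reply blocks it for good.\<close>
    have m': "move k ?g Up 1 t"
      using Z(1) D(3) t0 by (intro move_Up1[OF D(4)]) (auto simp: upd_apply Mid)
    let ?h = "upd ?g Up 1 t"
    have mid: "?h Mid 0 = t \<and> ?h Mid 1 = 0 \<or> ?h Mid 0 = 0 \<and> ?h Mid 1 = t"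
      using i Z(2) by (auto simp: upd_apply Mid)
    show ?thesis
    proof (cases "\<exists>l<k. f Low l = t")
      case True
      then obtain l where l: "l < k" "f Low l = t" by blast
      have "locked k t ?h"
        using lockedI[of t ?h l] mid l D(3) by (auto simp: upd_apply Mid)
      then show ?thesis
        using good_locked[OF k3] by (intro replyI[OF m']) auto
    next
      case False
      have "half t ?h"
        unfolding half_def using Z(1,3,4) D(3) mid False by (auto simp: upd_apply pal_other Mid)
      then show ?thesis
        using good_half by (intro replyI[OF m']) blast
    qed
  next
    case Low
    have i: "i < k" using D(1) Low by auto
    show ?thesis
    proof (cases "i = c")
      case True
      \<comment> \<open>On the empty upper path both directions are legal; the direction 1 is an
        arbitrary choice.\<close>
      have m': "move k ?g Up 1 1"
        using Z(1) by (intro move_Up1[OF D(4)]) (auto simp: upd_apply Low)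
      show ?thesis
      proof (rule replyI[OF m'])
        assume p: "pos k (upd ?g Up 1 1)"
        have "palindromic k (upd ?g Up 1 1 Low)"
          using pal_centre[of f t, OF Z(3)] pal_other[of Up] unfolding Low True by simp
        then show "cell k (upd ?g Up 1 1) \<or> upper_open (upd ?g Up 1 1) \<or> good k (upd ?g Up 1 1)"
          using good_symmetric[OF p] Z(1,2) t0 by (auto simp: upd_apply Low True)
      qed
    next
      case F: False
      have m': "move k ?g Low (k - 1 - i) t"
        using Z(1,2) t0 unfolding Low
        by (intro low_mirror_move[OF m[unfolded Low] Z(3) F]) auto
      let ?h = "upd ?g Low (k - 1 - i) t"
      have "?h Low c = 0" "?h Up j = 0" "?h Mid j = 0" for j
        using Z(1,2,4) F k i by (auto simp: upd_apply Low)
      then have "upper_open ?h"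
        unfolding upper_open_def using pal_mirror[of f i t, OF Z(3) i] unfolding Low by simp
      then show ?thesis
        by (intro replyI[OF m']) simp
    qed
  qed
  with nc show "\<not> cell k ?g \<and> reply k upper_open ?g" by simp
qed (use assms in auto)

end

section \<open>The opening position\<close>

abbreviation unmarked :: marking where
  "unmarked \<equiv> \<lambda>_ _. 0"

lemma zeros_unmarked: "zeros k unmarked = k + 5"
  by (simp add: zeros_def)

lemma valid_unmarked: "valid k unmarked"
  by (simp add: valid_def)

lemma not_cell_unmarked: "\<not> cell k unmarked"
  by (simp add: cell_iff)

lemma good_unmarked:
  assumes "2 \<le> k" "odd k"
  shows "good k unmarked"
proof -
  obtain c where "k = Suc (2 * c)" using assms(2) by (auto elim: oddE)
  with assms(1) interpret odd_board c k by unfold_locales auto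
  show ?thesis
    using good_upper_open[of unmarked] assms(2)
    by (simp add: upper_open_def palindromic_def pos_def valid_unmarked zeros_unmarked)
qed

lemma move_central:
  "move k unmarked Up 1 1"
  by (rule move_Up1) (auto simp: valid_unmarked)

lemma good_central:
  assumes "2 \<le> k" "even k"
  shows "good k (upd unmarked Up 1 1)"
proof (rule good_mirrored[OF assms(1)])
  show "pos k (upd unmarked Up 1 1)"
    using zeros_move[OF move_central, of k] moveD(4)[OF move_central, of k] assms(2)
    by (simp add: pos_def zeros_unmarked)
  have "refl k (upd unmarked Up 1 1) p i = upd unmarked Up 1 1 p i" for p i
    by (cases p) (auto simp: refl_def upd_apply)
  then have "refl k (upd unmarked Up 1 1) = upd unmarked Up 1 1"
    by (simp add: fun_eq_iff)
  moreover have "upd unmarked Up 1 1 p i \<noteq> 0" if "len k p = Suc (2 * i)" for p i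
  proof (cases p)
    case Up
    then have "i = 1" using that by simp
    with Up show ?thesis by (simp add: upd_apply)
  next
    case Mid
    then show ?thesis using that by simp
  next
    case Low
    then show ?thesis using that assms(2) by simp
  qed
  ultimately show "mirrored k (upd unmarked Up 1 1)"
    by (auto simp: mirrored_def cell_iff upd_apply)
qed

section \<open>Markings as positions on the board\<close>

definition node :: "nat \<Rightarrow> strand \<Rightarrow> nat \<Rightarrow> vertex" where
  "node k p i = (if i = 0 then Left_End else if i = len k p then Right_End
     else case p of Up \<Rightarrow> Upper i | Mid \<Rightarrow> Middle | Low \<Rightarrow> Lower i)"

definition arc :: "nat \<Rightarrow> strand \<Rightarrow> nat \<Rightarrow> int \<Rightarrow> vertex \<times> vertex" where
  "arc k p i s = (if s = 1 then (node k p i, node k p (Suc i)) else (node k p (Suc i), node k p i))"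

definition arcs :: "nat \<Rightarrow> marking \<Rightarrow> (vertex \<times> vertex) set" where
  "arcs k f = {arc k p i (f p i) | p i. i < len k p \<and> f p i \<noteq> 0}"

lemma set_zip_tl: "set (zip xs (tl xs)) = {(xs ! i, xs ! Suc i) | i. Suc i < length xs}"
proof -
  have "i < length (tl xs) \<longleftrightarrow> Suc i < length xs" for i by auto
  then show ?thesis by (auto simp: set_zip nth_tl)
qed

lemma set_zip_node_path:
  "set (zip (map (node k p) [0..<Suc n]) (tl (map (node k p) [0..<Suc n]))) = {(node k p i, node k p (Suc i)) | i. i < n}"
proof -
  have "map (node k p) [0..<Suc n] ! i = node k p i" if "i \<le> n" for i
    using that by (simp del: upt_Suc)
  then have "(\<exists>i. x = (map (node k p) [0..<Suc n] ! i, map (node k p) [0..<Suc n] ! Suc i) \<and> Suc i < Suc n) \<longleftrightarrow>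
      (\<exists>i. x = (node k p i, node k p (Suc i)) \<and> i < n)" for x
    by (metis Suc_leI less_imp_le Suc_less_eq)
  then show ?thesis
    unfolding set_zip_tl by (simp del: upt_Suc)
qed

lemma node_path:
  assumes "2 \<le> k"
  shows "upper_path 3 = map (node k Up) [0..<Suc (len k Up)]"
    "middle_path = map (node k Mid) [0..<Suc (len k Mid)]"
    "lower_path k = map (node k Low) [0..<Suc (len k Low)]"
proof -
  have "[0..<Suc k] = 0 # [1..<k] @ [k]"
    using assms upt_conv_Cons[of 0 k] by simp
  then show "lower_path k = map (node k Low) [0..<Suc (len k Low)]"
    using assms by (simp add: lower_path_def node_def)
qed (simp_all add: upper_path_def middle_path_def node_def upt_rec numeral_eq_Suc)

lemma edges_j2k:
  assumes "2 \<le> k"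
  shows "edges (j2k_board 3 k) = {{node k p i, node k p (Suc i)} | p i. i < len k p}"
proof -
  have "path_edges (map (node k p) [0..<Suc n]) = {{node k p i, node k p (Suc i)} | i. i < n}" for p n
    unfolding path_edges_def set_zip_node_path by blast
  then have "edges (j2k_board 3 k) = (\<Union>p\<in>{Up, Mid, Low}. {{node k p i, node k p (Suc i)} | i. i < len k p})"
    by (simp add: j2k_board_def node_path[OF assms] Un_assoc del: len.simps upt_Suc)
  moreover have "{Up, Mid, Low} = UNIV" using strand.exhaust by blast
  ultimately show ?thesis by auto
qed

lemma verts_j2k:
  assumes "2 \<le> k"
  shows "verts (j2k_board 3 k) = {node k p i | p i. i \<le> len k p}"
proof -
  have "set (map (node k p) [0..<Suc n]) = {node k p i | i. i \<le> n}" for p n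
    by (auto simp del: upt_Suc)
  then have "verts (j2k_board 3 k) = (\<Union>p\<in>{Up, Mid, Low}. {node k p i | i. i \<le> len k p})"
    by (simp add: j2k_board_def node_path[OF assms] Un_assoc del: len.simps upt_Suc)
  moreover have "{Up, Mid, Low} = UNIV" using strand.exhaust by blast
  ultimately show ?thesis by auto
qed

lemma len_ge2: "2 \<le> k \<Longrightarrow> 2 \<le> len k p"
  by (cases p) auto

lemma node_eq_ends:
  "i \<le> len k p \<Longrightarrow> 2 \<le> k \<Longrightarrow> node k p i = Left_End \<longleftrightarrow> i = 0"
  "i \<le> len k p \<Longrightarrow> 2 \<le> k \<Longrightarrow> node k p i = Right_End \<longleftrightarrow> i = len k p"
  by (cases p; auto simp: node_def)+

lemma node_eq_inner:
  assumes "2 \<le> k" "0 < i" "i < len k p" "j \<le> len k q"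
  shows "node k q j = node k p i \<longleftrightarrow> q = p \<and> j = i"
  using assms by (cases p; cases q) (auto simp: node_def)

text \<open>Every strand has at least two edges, so every edge has an inner endpoint, and an inner
  vertex determines its strand and its place there.\<close>

lemma edge_eq:
  assumes k: "2 \<le> k" and "i < len k p" "j < len k q"
    and eq: "{node k p i, node k p (Suc i)} = {node k q j, node k q (Suc j)}"
  shows "p = q \<and> i = j"
proof -
  have l: "2 \<le> len k p" "2 \<le> len k q" using len_ge2[OF k] by auto
  have inner: "q' = p' \<and> j' = i'" if "node k q' j' = node k p' i'" "0 < i'" "i' < len k p'" "j' \<le> len k q'" for p' i' q' j'
    using node_eq_inner[OF k that(2-4)] that(1) by simp
  consider "0 < i" | "i = 0" "Suc i < len k p" using l by linarith
  then show ?thesis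
  proof cases
    case 1
    then have "node k p i = node k q j \<or> node k p i = node k q (Suc j)" using eq by (auto simp: doubleton_eq_iff)
    then show ?thesis
    proof
      assume "node k p i = node k q j"
      then show ?thesis using inner[of q j p i] 1 assms(2,3) by auto
    next
      assume "node k p i = node k q (Suc j)"
      then have e: "q = p" "Suc j = i" using inner[of q "Suc j" p i] 1 assms(2,3) by auto
      then have "node k p (Suc i) = node k p j"
        using eq by (auto simp: doubleton_eq_iff)
      then show ?thesis using e inner[of p "Suc i" p j] node_eq_ends[of "Suc i" k p] k assms(2) by (cases "j = 0") (auto simp: node_def)
    qed
  next
    case 2
    then have "node k p (Suc i) = node k q j \<or> node k p (Suc i) = node k q (Suc j)" using eq by (auto simp: doubleton_eq_iff)
    then show ?thesis
    proof
      assume "node k p (Suc i) = node k q (Suc j)"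
      then show ?thesis using inner[of q "Suc j" p "Suc i"] 2 assms(2,3) by auto
    next
      assume "node k p (Suc i) = node k q j"
      then have e: "q = p" "j = Suc i" using inner[of q j p "Suc i"] 2 assms(2,3) by auto
      then have "node k p i = node k p (Suc j)"
        using eq by (auto simp: doubleton_eq_iff)
      then show ?thesis using 2 e node_eq_ends[of "Suc j" k p] k assms(3) by (auto simp: node_def)
    qed
  qed
qed

lemma node_neq: "2 \<le> k \<Longrightarrow> i < len k p \<Longrightarrow> node k p i \<noteq> node k p (Suc i)"
  by (cases p) (auto simp: node_def)

lemma arc_in_arcs:
  assumes k: "2 \<le> k" and v: "\<And>p i. i < len k p \<Longrightarrow> f p i \<in> {-1, 0, 1}" and i: "i < len k p" and s: "s \<in> {1, -1}"
  shows "arc k p i s \<in> arcs k f \<longleftrightarrow> f p i = s"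
proof
  assume "arc k p i s \<in> arcs k f"
  then obtain q j where q: "j < len k q" "f q j \<noteq> 0" "arc k p i s = arc k q j (f q j)"
    by (auto simp: arcs_def)
  have "{node k p i, node k p (Suc i)} = {node k q j, node k q (Suc j)}"
    using q(3) by (auto simp: arc_def split: if_splits)
  then have e: "p = q" "i = j" using edge_eq[OF k i q(1)] by auto
  have "f p i \<in> {1, -1}" using v[OF i] q(2) e by auto
  with q(3) e s node_neq[OF k i] show "f p i = s" by (auto simp: arc_def split: if_splits)
next
  assume "f p i = s"
  moreover have "s \<noteq> 0" using s by auto
  ultimately show "arc k p i s \<in> arcs k f"
    using i unfolding arcs_def by blast
qed

lemma arcs_upd:
  assumes "i < len k p" "f p i = 0" "s \<noteq> 0"
  shows "arcs k (upd f p i s) = insert (arc k p i s) (arcs k f)"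
  using assms unfolding arcs_def by (auto simp: upd_apply split: if_splits)

lemma edge_at_iff:
  assumes "2 \<le> k"
  shows "{v, w} \<in> edges (j2k_board 3 k) \<longleftrightarrow>
    (\<exists>p i. i < len k p \<and> (v = node k p i \<and> w = node k p (Suc i) \<or> w = node k p i \<and> v = node k p (Suc i)))"
  unfolding edges_j2k[OF assms] by (simp add: doubleton_eq_iff) blast

section \<open>Sinks and sources in terms of signs\<close>

context
  fixes k :: nat and f :: marking
  assumes k: "2 \<le> k" and signs: "\<And>p i. i < len k p \<Longrightarrow> f p i \<in> {-1, 0, 1}"
begin

lemma arcs_iff:
  assumes "i < len k p"
  shows "(node k p i, node k p (Suc i)) \<in> arcs k f \<longleftrightarrow> f p i = 1"
    "(node k p (Suc i), node k p i) \<in> arcs k f \<longleftrightarrow> f p i = -1"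
  using arc_in_arcs[OF k signs assms, where s = 1] arc_in_arcs[OF k signs assms, where s = "-1"]
  by (simp_all add: arc_def)

lemma sink_iff:
  "sink (j2k_board 3 k) (arcs k f) v \<longleftrightarrow>
    (\<forall>p i. i < len k p \<longrightarrow> (node k p i = v \<longrightarrow> f p i = -1) \<and> (node k p (Suc i) = v \<longrightarrow> f p i = 1))"
  unfolding sink_def edge_at_iff[OF k] using arcs_iff by blast

lemma source_iff:
  "source (j2k_board 3 k) (arcs k f) v \<longleftrightarrow>
    (\<forall>p i. i < len k p \<longrightarrow> (node k p i = v \<longrightarrow> f p i = 1) \<and> (node k p (Suc i) = v \<longrightarrow> f p i = -1))"
  unfolding source_def edge_at_iff[OF k] using arcs_iff by blast

lemma len_pos: "0 < len k p"
  using len_ge2[OF k, of p] by simp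

lemma sink_source_Left:
  "sink (j2k_board 3 k) (arcs k f) Left_End \<longleftrightarrow> (\<forall>p. f p 0 = -1)"
  "source (j2k_board 3 k) (arcs k f) Left_End \<longleftrightarrow> (\<forall>p. f p 0 = 1)"
  unfolding sink_iff source_iff using len_pos k by (auto simp: node_eq_ends)

lemma sink_source_Right:
  "sink (j2k_board 3 k) (arcs k f) Right_End \<longleftrightarrow> (\<forall>p. f p (len k p - 1) = 1)"
  "source (j2k_board 3 k) (arcs k f) Right_End \<longleftrightarrow> (\<forall>p. f p (len k p - 1) = -1)"
proof -
  have "node k p i \<noteq> Right_End" "node k p (Suc i) = Right_End \<longleftrightarrow> i = len k p - 1" if "i < len k p" for i p
    using that k by (auto simp: node_eq_ends Suc_leI)
  then have "(\<forall>p i. i < len k p \<longrightarrow> (node k p i = Right_End \<longrightarrow> P p i) \<and> (node k p (Suc i) = Right_End \<longrightarrow> Q p i))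
    \<longleftrightarrow> (\<forall>p i. i < len k p \<longrightarrow> i = len k p - 1 \<longrightarrow> Q p i)" for P Q :: "strand \<Rightarrow> nat \<Rightarrow> bool"
    by (simp cong: imp_cong)
  moreover have "(\<forall>i. i < len k p \<longrightarrow> i = len k p - 1 \<longrightarrow> R i) \<longleftrightarrow> R (len k p - 1)" for p R
    using len_pos[of p] by auto
  ultimately have *: "(\<forall>p i. i < len k p \<longrightarrow> (node k p i = Right_End \<longrightarrow> P p i) \<and> (node k p (Suc i) = Right_End \<longrightarrow> Q p i))
    \<longleftrightarrow> (\<forall>p. Q p (len k p - 1))" for P Q :: "strand \<Rightarrow> nat \<Rightarrow> bool"
    by simp
  show "sink (j2k_board 3 k) (arcs k f) Right_End \<longleftrightarrow> (\<forall>p. f p (len k p - 1) = 1)"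
    "source (j2k_board 3 k) (arcs k f) Right_End \<longleftrightarrow> (\<forall>p. f p (len k p - 1) = -1)"
    unfolding sink_iff source_iff * by simp_all
qed

lemma sink_source_inner:
  assumes "Suc j < len k p"
  shows "sink (j2k_board 3 k) (arcs k f) (node k p (Suc j)) \<longleftrightarrow> f p j = 1 \<and> f p (Suc j) = -1"
    "source (j2k_board 3 k) (arcs k f) (node k p (Suc j)) \<longleftrightarrow> f p j = -1 \<and> f p (Suc j) = 1"
proof -
  have "node k q i = node k p (Suc j) \<longleftrightarrow> q = p \<and> i = Suc j"
      "node k q (Suc i) = node k p (Suc j) \<longleftrightarrow> q = p \<and> i = j" if "i < len k q" for q i
    using node_eq_inner[OF k _ assms, of i q] node_eq_inner[OF k _ assms, of "Suc i" q] that by auto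
  then have *: "(\<forall>q i. i < len k q \<longrightarrow> (node k q i = node k p (Suc j) \<longrightarrow> P q i) \<and> (node k q (Suc i) = node k p (Suc j) \<longrightarrow> Q q i))
    \<longleftrightarrow> P p (Suc j) \<and> Q p j" for P Q
    using assms by (metis Suc_lessD)
  show "sink (j2k_board 3 k) (arcs k f) (node k p (Suc j)) \<longleftrightarrow> f p j = 1 \<and> f p (Suc j) = -1"
    "source (j2k_board 3 k) (arcs k f) (node k p (Suc j)) \<longleftrightarrow> f p j = -1 \<and> f p (Suc j) = 1"
    unfolding sink_iff source_iff * by auto
qed

text \<open>Only the range of the values is assumed, because this has to judge also the marking
  after a move whose legality is still open.\<close>

lemma valid_iff:
  "valid k f \<longleftrightarrow> (\<forall>v\<in>verts (j2k_board 3 k).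
     \<not> sink (j2k_board 3 k) (arcs k f) v \<and> \<not> source (j2k_board 3 k) (arcs k f) v)"
proof -
  have nz: "len k p \<noteq> 0" for p using len_pos[of p] by simp
  have "v \<in> verts (j2k_board 3 k) \<longleftrightarrow> v = Left_End \<or> v = Right_End \<or> (\<exists>p j. Suc j < len k p \<and> v = node k p (Suc j))" for v
  proof -
    have "v \<in> verts (j2k_board 3 k) \<longleftrightarrow> (\<exists>p i. i \<le> len k p \<and> v = node k p i)"
      by (auto simp: verts_j2k[OF k])
    also have "\<dots> \<longleftrightarrow> (\<exists>p i. i = 0 \<and> v = node k p i) \<or> (\<exists>p i. i = len k p \<and> v = node k p i) \<or>
        (\<exists>p j. Suc j < len k p \<and> v = node k p (Suc j))"
      by (metis le_eq_less_or_eq not0_implies_Suc zero_le)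
    also have "\<dots> \<longleftrightarrow> v = Left_End \<or> v = Right_End \<or> (\<exists>p j. Suc j < len k p \<and> v = node k p (Suc j))"
    proof -
      have "node k p 0 = Left_End" "node k p (len k p) = Right_End" for p
        by (simp_all add: node_def nz)
      then show ?thesis by auto
    qed
    finally show ?thesis .
  qed
  then have "(\<forall>v\<in>verts (j2k_board 3 k). P v) \<longleftrightarrow>
      P Left_End \<and> P Right_End \<and> (\<forall>p j. Suc j < len k p \<longrightarrow> P (node k p (Suc j)))" for P
    unfolding Ball_def by auto
  then have "(\<forall>v\<in>verts (j2k_board 3 k).
      \<not> sink (j2k_board 3 k) (arcs k f) v \<and> \<not> source (j2k_board 3 k) (arcs k f) v) \<longleftrightarrow>
    (\<not> (\<forall>p. f p 0 = -1) \<and> \<not> (\<forall>p. f p 0 = 1)) \<and>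
    (\<not> (\<forall>p. f p (len k p - 1) = 1) \<and> \<not> (\<forall>p. f p (len k p - 1) = -1)) \<and>
    (\<forall>p j. Suc j < len k p \<longrightarrow> \<not> (f p j = 1 \<and> f p (Suc j) = -1) \<and> \<not> (f p j = -1 \<and> f p (Suc j) = 1))"
    by (simp only: sink_source_Left sink_source_Right sink_source_inner cong: imp_cong)
  moreover have "(f p j \<noteq> 0 \<longrightarrow> f p (Suc j) \<noteq> - f p j) \<longleftrightarrow>
      \<not> (f p j = 1 \<and> f p (Suc j) = -1) \<and> \<not> (f p j = -1 \<and> f p (Suc j) = 1)" if "Suc j < len k p" for p j
    using signs[of j p] signs[of "Suc j" p] that by auto
  then have "(\<forall>p j. Suc j < len k p \<longrightarrow> f p j \<noteq> 0 \<longrightarrow> f p (Suc j) \<noteq> - f p j) \<longleftrightarrow>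
      (\<forall>p j. Suc j < len k p \<longrightarrow> \<not> (f p j = 1 \<and> f p (Suc j) = -1) \<and> \<not> (f p j = -1 \<and> f p (Suc j) = 1))"
    by blast
  moreover have "(\<forall>s\<in>{1, -1}. \<not> (\<forall>p. f p 0 = s) \<and> \<not> (\<forall>p. f p (len k p - 1) = s)) \<longleftrightarrow>
      (\<not> (\<forall>p. f p 0 = 1) \<and> \<not> (\<forall>p. f p (len k p - 1) = 1)) \<and>
      (\<not> (\<forall>p. f p 0 = -1) \<and> \<not> (\<forall>p. f p (len k p - 1) = -1))"
    by blast
  moreover have "(\<forall>p i. i < len k p \<longrightarrow> f p i \<in> {-1, 0, 1}) \<longleftrightarrow> True"
    using signs by blast
  ultimately show ?thesis
    unfolding valid_def by argo
qed

end

section \<open>Translation of the game between arcs and markings\<close>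

lemma move_legal:
  assumes k: "2 \<le> k" and v: "valid k f" and m: "move k f p i s"
  shows "legal_move (j2k_board 3 k) (arcs k f) (arc k p i s)"
    "insert (arc k p i s) (arcs k f) = arcs k (upd f p i s)"
proof -
  note D = moveD[OF m]
  have sg: "\<And>p i. i < len k p \<Longrightarrow> f p i \<in> {-1, 0, 1}" and
    sg': "\<And>q j. j < len k q \<Longrightarrow> upd f p i s q j \<in> {-1, 0, 1}"
    using v D(4) unfolding valid_def by blast+
  show eq: "insert (arc k p i s) (arcs k f) = arcs k (upd f p i s)"
    using arcs_upd[of i k p f s] D(1,2,3) by auto
  have "{fst (arc k p i s), snd (arc k p i s)} \<in> edges (j2k_board 3 k)"
    using D(1) by (auto simp: edge_at_iff[OF k] arc_def)
  moreover have "(fst (arc k p i s), snd (arc k p i s)) \<notin> arcs k f" "(snd (arc k p i s), fst (arc k p i s)) \<notin> arcs k f"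
    using arcs_iff[OF k sg D(1)] D(2) by (auto simp: arc_def)
  ultimately show "legal_move (j2k_board 3 k) (arcs k f) (arc k p i s)"
    using valid_iff[of k "upd f p i s", OF k sg'] D(4) by (simp add: legal_move_def eq)
qed

lemma legal_move_cases:
  assumes k: "2 \<le> k" and v: "valid k f" and l: "legal_move (j2k_board 3 k) (arcs k f) m"
  obtains p i s where "move k f p i s" "m = arc k p i s"
proof -
  have sg: "\<And>p i. i < len k p \<Longrightarrow> f p i \<in> {-1, 0, 1}"
    using v unfolding valid_def by blast
  from l have e: "{fst m, snd m} \<in> edges (j2k_board 3 k)"
    and n: "(fst m, snd m) \<notin> arcs k f" "(snd m, fst m) \<notin> arcs k f"
    and ok: "\<forall>v\<in>verts (j2k_board 3 k). \<not> sink (j2k_board 3 k) (insert m (arcs k f)) v \<and>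
      \<not> source (j2k_board 3 k) (insert m (arcs k f)) v"
    by (auto simp: legal_move_def)
  obtain p i s where i: "i < len k p" and s: "s \<in> {1, -1}" and m: "m = arc k p i s"
  proof -
    obtain p i where i: "i < len k p"
      "fst m = node k p i \<and> snd m = node k p (Suc i) \<or> snd m = node k p i \<and> fst m = node k p (Suc i)"
      using e unfolding edge_at_iff[OF k] by blast
    then have "m = arc k p i 1 \<or> m = arc k p i (-1)"
      by (auto simp: arc_def prod_eq_iff)
    then show thesis using that[OF i(1), of 1] that[OF i(1), of "-1"] by auto
  qed
  have f0: "f p i = 0"
    using n arcs_iff[OF k sg i] sg[OF i] s by (auto simp: m arc_def)
  have sg': "upd f p i s q j \<in> {-1, 0, 1}" if "j < len k q" for q j
    using sg[OF that] s by (auto simp: upd_apply)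
  have "insert m (arcs k f) = arcs k (upd f p i s)"
    using arcs_upd[of i k p f s] i f0 s m by auto
  then have "valid k (upd f p i s)"
    using ok valid_iff[of k "upd f p i s", OF k sg'] by simp
  then show thesis using that i f0 s m by (auto simp: move_def)
qed

text \<open>Lets the opposite orientation of a cell be read off from the closed form in
  \<open>cycle_arcs_snoc\<close>.\<close>

lemma cycle_arcs_rev_snoc:
  assumes "p \<noteq> []"
  shows "cycle_arcs (rev (p @ [m])) = (cycle_arcs (p @ [m]))\<inverse>"
proof -
  obtain a q where p: "p = a # q" using assms by (cases p) auto
  have "cycle_arcs (rev (p @ [m])) = set (zip (rev (p @ [m])) (rev (m # p)))"
    by (simp add: cycle_arcs_def)
  also have "\<dots> = set (zip (p @ [m]) (m # p))"
    using zip_rev[of "p @ [m]" "m # p"] by (simp only: length_append_singleton length_Cons set_rev)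
  also have "\<dots> = insert (a, m) (set (zip (q @ [m]) (a # q)))"
    by (simp add: p)
  also have "set (zip (q @ [m]) (a # q)) = (set (zip (a # q) q))\<inverse> \<union> {(m, last (a # q))}"
    by (induction q arbitrary: a) auto
  finally have "cycle_arcs (rev (p @ [m])) = insert (a, m) ((set (zip (a # q) q))\<inverse> \<union> {(m, last (a # q))})" .
  moreover have "cycle_arcs (p @ [m]) = set (zip (a # q) q) \<union> {(last (a # q), m), (m, a)}"
    using cycle_arcs_snoc[OF assms, of m] unfolding p by (simp only: list.sel)
  ultimately show ?thesis
    by auto
qed

lemma cell_completed_iff:
  assumes k: "2 \<le> k" and v: "valid k f"
  shows "cell_completed (j2k_board 3 k) (arcs k f) \<longleftrightarrow> cell k f"
proof -
  have sg: "\<And>p i. i < len k p \<Longrightarrow> f p i \<in> {-1, 0, 1}"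
    using v unfolding valid_def by blast
  note A = arcs_iff[OF k sg]
  let ?p = "\<lambda>p. map (node k p) [0..<Suc (len k p)]"
  have mid: "node k Mid 0 = Left_End" "node k Mid (Suc 0) = Middle" "node k Mid (Suc (Suc 0)) = Right_End"
    by (simp_all add: node_def)
  have M: "(Middle, Left_End) \<in> arcs k f \<longleftrightarrow> f Mid 0 = -1" "(Left_End, Middle) \<in> arcs k f \<longleftrightarrow> f Mid 0 = 1"
     "(Right_End, Middle) \<in> arcs k f \<longleftrightarrow> f Mid 1 = -1" "(Middle, Right_End) \<in> arcs k f \<longleftrightarrow> f Mid 1 = 1"
    using A[where i = 0 and p = Mid] A[where i = 1 and p = Mid] by (simp_all add: mid)
  have ne: "?p p \<noteq> []" and "hd (?p p) = Left_End" and "last (?p p) = Right_End" for p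
    using len_ge2[OF k, of p] by (auto simp: node_def hd_map last_map simp del: upt_Suc)
  then have C: "cycle_arcs (?p p @ [Middle]) =
      {(node k p i, node k p (Suc i)) | i. i < len k p} \<union> {(Right_End, Middle), (Middle, Left_End)}" for p
    unfolding cycle_arcs_snoc[OF ne] set_zip_node_path by simp
  have sub: "{g i | i. i < n} \<subseteq> D \<longleftrightarrow> (\<forall>i<n. g i \<in> D)" for g :: "nat \<Rightarrow> vertex \<times> vertex" and n D
    by blast
  have D: "cycle_arcs (rev (?p p @ [Middle])) =
      {(node k p (Suc i), node k p i) | i. i < len k p} \<union> {(Middle, Right_End), (Left_End, Middle)}" for p
    unfolding cycle_arcs_rev_snoc[OF ne] C by auto
  have "cycle_arcs (?p p @ [Middle]) \<subseteq> arcs k f \<longleftrightarrow> (\<forall>i<len k p. f p i = 1) \<and> f Mid 0 = -1 \<and> f Mid 1 = -1" for p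
    unfolding C Un_subset_iff insert_subset sub M using A(1)[where p = p] by auto
  moreover have "cycle_arcs (rev (?p p @ [Middle])) \<subseteq> arcs k f \<longleftrightarrow> (\<forall>i<len k p. f p i = -1) \<and> f Mid 0 = 1 \<and> f Mid 1 = 1" for p
    unfolding D Un_subset_iff insert_subset sub M using A(2)[where p = p] by auto
  moreover have "cells (j2k_board 3 k) = {?p Up @ [Middle], ?p Low @ [Middle]}"
    by (simp add: j2k_board_def node_path[OF k] del: upt_Suc len.simps)
  ultimately have "cell_completed (j2k_board 3 k) (arcs k f) \<longleftrightarrow>
     (\<exists>p\<in>{Up, Low}. (\<forall>i<len k p. f p i = 1) \<and> f Mid 0 = -1 \<and> f Mid 1 = -1 \<or>
        (\<forall>i<len k p. f p i = -1) \<and> f Mid 0 = 1 \<and> f Mid 1 = 1)"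
    unfolding cell_completed_def by (simp only: bex_simps simp_thms)
  moreover have "(\<forall>i<2. f Mid i = 1) \<longleftrightarrow> f Mid 0 = 1 \<and> f Mid 1 = 1"
      "(\<forall>i<2. f Mid i = -1) \<longleftrightarrow> f Mid 0 = -1 \<and> f Mid 1 = -1"
    by (auto simp: less2)
  ultimately show ?thesis
    unfolding cell_def bex_simps simp_thms minus_minus by argo
qed

text \<open>Both inductive notions have the same shape. The induction carries \<open>valid\<close>
  along, since the translation of moves and cells rests on it.\<close>

lemma good_secured:
  assumes k: "2 \<le> k"
  shows "good k f \<Longrightarrow> valid k f \<Longrightarrow> secured (j2k_board 3 k) (arcs k f)"
proof (induction rule: good.induct)
  case (goodI f)
  show ?case
  proof (rule securedI)
    fix m assume "legal_move (j2k_board 3 k) (arcs k f) m"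
    then obtain p i s where m: "move k f p i s" "m = arc k p i s"
      using legal_move_cases[OF k goodI.prems] by blast
    let ?g = "upd f p i s"
    have v: "valid k ?g" using moveD(4)[OF m(1)] .
    have eq: "insert m (arcs k f) = arcs k ?g" using move_legal(2)[OF k goodI.prems m(1)] m(2) by simp
    obtain q j t where m': "move k ?g q j t" and nc: "\<not> cell k ?g"
      and h: "cell k (upd ?g q j t) \<or> (valid k (upd ?g q j t) \<longrightarrow> secured (j2k_board 3 k) (arcs k (upd ?g q j t)))"
      using goodI.IH[OF m(1)] by blast
    have v': "valid k (upd ?g q j t)" using moveD(4)[OF m'] .
    show "\<not> cell_completed (j2k_board 3 k) (insert m (arcs k f)) \<and>
      (\<exists>m'. legal_move (j2k_board 3 k) (insert m (arcs k f)) m' \<and>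
        (cell_completed (j2k_board 3 k) (insert m' (insert m (arcs k f))) \<or>
         secured (j2k_board 3 k) (insert m' (insert m (arcs k f)))))"
      unfolding eq
    proof (intro conjI exI)
      show "legal_move (j2k_board 3 k) (arcs k ?g) (arc k q j t)"
        using move_legal(1)[OF k v m'] .
      show "cell_completed (j2k_board 3 k) (insert (arc k q j t) (arcs k ?g)) \<or>
         secured (j2k_board 3 k) (insert (arc k q j t) (arcs k ?g))"
        unfolding move_legal(2)[OF k v m'] using h v' cell_completed_iff[OF k v'] by blast
    qed (use nc cell_completed_iff[OF k v] in simp)
  qed
qed

lemma arcs_unmarked: "arcs k unmarked = {}"
  by (simp add: arcs_def)

theorem theorem3:
  fixes k :: nat
  assumes "k \<ge> 2"
  shows "(even k \<longrightarrow> has_winning_strategy (j2k_board 3 k) Player1) \<and>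
         (odd k \<longrightarrow> has_winning_strategy (j2k_board 3 k) Player2)"
proof (intro conjI impI)
  have start: "\<not> cell_completed (j2k_board 3 k) {}"
    using cell_completed_iff[OF assms valid_unmarked] not_cell_unmarked by (simp add: arcs_unmarked)
  have legal: "legal_move (j2k_board 3 k) {} (arc k Up 1 1)"
    and central: "insert (arc k Up 1 1) {} = arcs k (upd unmarked Up 1 1)"
    using move_legal[OF assms valid_unmarked move_central] by (simp_all only: arcs_unmarked)
  {
    assume "even k"
    then have "secured (j2k_board 3 k) (insert (arc k Up 1 1) {})"
      using good_secured[OF assms good_central[OF assms]] moveD(4)[OF move_central] by (simp only: central)
    then have "answer (j2k_board 3 k) {} (arc k Up 1 1)"
      using legal by (simp add: answer_def)
    then show "has_winning_strategy (j2k_board 3 k) Player1"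
      using start by (intro has_winning_strategyI) blast+
  next
    assume "odd k"
    then have "secured (j2k_board 3 k) {}"
      using good_secured[OF assms good_unmarked[OF assms \<open>odd k\<close>] valid_unmarked]
      by (simp only: arcs_unmarked)
    moreover have "\<not> game_over (j2k_board 3 k) {}"
      using start legal unfolding game_over_def by blast
    ultimately show "has_winning_strategy (j2k_board 3 k) Player2"
      by (intro has_winning_strategyI) simp_all
  }
qed

end
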